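(* Let $h\colon[n]\to[n]$ be a Hessenberg function and let $w\in\mathfrak S_n$ be a generator for $h$. If $w$ avoids all of the associated patterns $[2143]_h$, $[1324]_h$, $[1243]_h$, $[2134]_h$, $[1423]_h$, $[2314]_h$, and $[2413]_h$, then the graph $\Gamma_{w,h}$ is regular.
   Context: A Hessenberg function is a nondecreasing $h\colon[n]\to[n]$ with $h(i)\ge i$. For $u\in\mathfrak S_n$ (one-line notation) and $i<j$, $u(i,j)$ is obtained from $u$ by swapping the entries in positions $i$ and $j$. The Bruhat order $\preceq$ is the reflexive–transitive closure of $u\prec u(i,j)$ when $u(i,j)$ has more inversions than $u$; $w_0=n(n-1)\cdots1$, $[w,w_0]=\{u\mid w\preceq u\preceq w_0\}$. A generator for $h$ is a $w$ with $w^{-1}(w(i)+1)\le h(i)$ whenever $w(i)\le n-1$. $\Gamma_h$ is the graph with vertex set $\mathfrak S_n$ and edges $\{u,u(i,j)\}$ for $1\le i<j\le h(i)$; for a generator $w$, $\Gamma_{w,h}$ is the subgraph of $\Gamma_h$ induced on $[w,w_0]$. A graph is regular if all vertices have the same degree. $w$ avoids a pattern if it does not contain it. Associated patterns: $w$ contains $[2143]_h$ if $w(j)<w(i)<w(\ell)<w(k)$ for some $i<j<k<\ell\le h(i)$; $[1324]_h$ if $w(i)<w(k)<w(j)<w(\ell)$ for some $i<j<k<\ell\le h(j)$ with $k\le h(i)$; $[1243]_h$ if $w(i)<w(j)<w(\ell)<w(k)$ for some $i<j<k<\ell\le h(j)$ with $j\le h(i)<\ell$; $[2134]_h$ if $w(j)<w(i)<w(k)<w(\ell)$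 for some $i<j<k<\ell\le h(k)$ with $k\le h(i)<\ell$; $[1423]_h$ if $w(i)<w(k)<w(\ell)<w(j)$ for some $i<j<k<\ell\le h(j)$ with $k\le h(i)<\ell$; $[2314]_h$ if $w(k)<w(i)<w(j)<w(\ell)$ for some $i<j<k<\ell\le h(j)$ with $k\le h(i)<\ell$; $[2413]_h$ if $w(k)<w(i)<w(\ell)<w(j)$ for some $i<j\le h(i)<k\le h(j)<\ell\le h(k)$. *)

theory Defs
  imports "HOL-Combinatorics.Permutations" "HOL-Library.FuncSet"
begin

text \<open>
  The set \<open>[n]\<close> is \<open>{1..n}\<close>. A permutation in the symmetric group on \<open>[n]\<close> is a function
  \<open>w :: nat \<Rightarrow> nat\<close> with \<open>w permutes {1..n}\<close>, so it fixes every number outside \<open>[n]\<close>; its one-line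
  notation is \<open>w 1, ..., w n\<close>. A Hessenberg function is constrained on \<open>[n]\<close> only.
\<close>

definition symmetric_group :: "nat \<Rightarrow> (nat \<Rightarrow> nat) set" where
  "symmetric_group n = {w. w permutes {1..n}}"

definition hessenberg :: "nat \<Rightarrow> (nat \<Rightarrow> nat) \<Rightarrow> bool" where
  "hessenberg n h \<longleftrightarrow>
     h \<in> {1..n} \<rightarrow> {1..n} \<and> mono_on {1..n} h \<and> (\<forall>i\<in>{1..n}. i \<le> h i)"

text \<open>The permutation \<open>u(i,j)\<close>: composing on the right swaps positions, not values.\<close>

definition swap_positions :: "(nat \<Rightarrow> nat) \<Rightarrow> nat \<Rightarrow> nat \<Rightarrow> nat \<Rightarrow> nat" where
  "swap_positions u i j = u \<circ> transpose i j"

definition inversions :: "nat \<Rightarrow> (nat \<Rightarrow> nat) \<Rightarrow> nat" where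
  "inversions n u = card {(i, j). 1 \<le> i \<and> i < j \<and> j \<le> n \<and> u j < u i}"

definition bruhat_step :: "nat \<Rightarrow> (nat \<Rightarrow> nat) \<Rightarrow> (nat \<Rightarrow> nat) \<Rightarrow> bool" where
  "bruhat_step n u v \<longleftrightarrow> u \<in> symmetric_group n \<and>
     (\<exists>i j. 1 \<le> i \<and> i < j \<and> j \<le> n \<and> v = swap_positions u i j \<and> inversions n u < inversions n v)"

definition bruhat_le :: "nat \<Rightarrow> (nat \<Rightarrow> nat) \<Rightarrow> (nat \<Rightarrow> nat) \<Rightarrow> bool" where
  "bruhat_le n = (bruhat_step n)\<^sup>*\<^sup>*"

definition longest_perm :: "nat \<Rightarrow> nat \<Rightarrow> nat" where
  "longest_perm n i = (if i \<in> {1..n} then n + 1 - i else i)"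

definition bruhat_interval :: "nat \<Rightarrow> (nat \<Rightarrow> nat) \<Rightarrow> (nat \<Rightarrow> nat) \<Rightarrow> (nat \<Rightarrow> nat) set" where
  "bruhat_interval n v w = {u \<in> symmetric_group n. bruhat_le n v u \<and> bruhat_le n u w}"

definition is_generator :: "nat \<Rightarrow> (nat \<Rightarrow> nat) \<Rightarrow> (nat \<Rightarrow> nat) \<Rightarrow> bool" where
  "is_generator n h w \<longleftrightarrow> w \<in> symmetric_group n \<and>
     (\<forall>i\<in>{1..n}. w i \<le> n - 1 \<longrightarrow> inv w (w i + 1) \<le> h i)"

text \<open>
  Simple graphs are pairs of a vertex set and a set of edges, each edge being a set of two
  distinct vertices. All graphs below are finite, so that \<open>card\<close> gives the degree.
\<close>

type_synonym 'a sgraph = "'a set \<times> 'a set set"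

definition induced_subgraph :: "'a sgraph \<Rightarrow> 'a set \<Rightarrow> 'a sgraph" where
  "induced_subgraph G W = (fst G \<inter> W, {e \<in> snd G. e \<subseteq> W})"

definition degree :: "'a sgraph \<Rightarrow> 'a \<Rightarrow> nat" where
  "degree G v = card {e \<in> snd G. v \<in> e}"

definition regular_graph :: "'a sgraph \<Rightarrow> bool" where
  "regular_graph G \<longleftrightarrow> (\<forall>u\<in>fst G. \<forall>v\<in>fst G. degree G u = degree G v)"

definition Gamma_h :: "nat \<Rightarrow> (nat \<Rightarrow> nat) \<Rightarrow> (nat \<Rightarrow> nat) sgraph" where
  "Gamma_h n h =
     (symmetric_group n,
      {{u, swap_positions u i j} | u i j.
         u \<in> symmetric_group n \<and> i \<in> {1..n} \<and> i < j \<and> j \<le> h i})"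

definition Gamma_wh :: "nat \<Rightarrow> (nat \<Rightarrow> nat) \<Rightarrow> (nat \<Rightarrow> nat) \<Rightarrow> (nat \<Rightarrow> nat) sgraph" where
  "Gamma_wh n w h = induced_subgraph (Gamma_h n h) (bruhat_interval n w (longest_perm n))"

definition contains_2143 :: "nat \<Rightarrow> (nat \<Rightarrow> nat) \<Rightarrow> (nat \<Rightarrow> nat) \<Rightarrow> bool" where
  "contains_2143 n h w \<longleftrightarrow>
     (\<exists>i\<in>{1..n}. \<exists>j\<in>{1..n}. \<exists>k\<in>{1..n}. \<exists>l\<in>{1..n}.
        w j < w i \<and> w i < w l \<and> w l < w k \<and>
        i < j \<and> j < k \<and> k < l \<and> l \<le> h i)"

definition contains_1324 :: "nat \<Rightarrow> (nat \<Rightarrow> nat) \<Rightarrow> (nat \<Rightarrow> nat) \<Rightarrow> bool" where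
  "contains_1324 n h w \<longleftrightarrow>
     (\<exists>i\<in>{1..n}. \<exists>j\<in>{1..n}. \<exists>k\<in>{1..n}. \<exists>l\<in>{1..n}.
        w i < w k \<and> w k < w j \<and> w j < w l \<and>
        i < j \<and> j < k \<and> k < l \<and> l \<le> h j \<and> k \<le> h i)"

definition contains_1243 :: "nat \<Rightarrow> (nat \<Rightarrow> nat) \<Rightarrow> (nat \<Rightarrow> nat) \<Rightarrow> bool" where
  "contains_1243 n h w \<longleftrightarrow>
     (\<exists>i\<in>{1..n}. \<exists>j\<in>{1..n}. \<exists>k\<in>{1..n}. \<exists>l\<in>{1..n}.
        w i < w j \<and> w j < w l \<and> w l < w k \<and>
        i < j \<and> j < k \<and> k < l \<and> l \<le> h j \<and> j \<le> h i \<and> h i < l)"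

definition contains_2134 :: "nat \<Rightarrow> (nat \<Rightarrow> nat) \<Rightarrow> (nat \<Rightarrow> nat) \<Rightarrow> bool" where
  "contains_2134 n h w \<longleftrightarrow>
     (\<exists>i\<in>{1..n}. \<exists>j\<in>{1..n}. \<exists>k\<in>{1..n}. \<exists>l\<in>{1..n}.
        w j < w i \<and> w i < w k \<and> w k < w l \<and>
        i < j \<and> j < k \<and> k < l \<and> l \<le> h k \<and> k \<le> h i \<and> h i < l)"

definition contains_1423 :: "nat \<Rightarrow> (nat \<Rightarrow> nat) \<Rightarrow> (nat \<Rightarrow> nat) \<Rightarrow> bool" where
  "contains_1423 n h w \<longleftrightarrow>
     (\<exists>i\<in>{1..n}. \<exists>j\<in>{1..n}. \<exists>k\<in>{1..n}. \<exists>l\<in>{1..n}.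
        w i < w k \<and> w k < w l \<and> w l < w j \<and>
        i < j \<and> j < k \<and> k < l \<and> l \<le> h j \<and> k \<le> h i \<and> h i < l)"

definition contains_2314 :: "nat \<Rightarrow> (nat \<Rightarrow> nat) \<Rightarrow> (nat \<Rightarrow> nat) \<Rightarrow> bool" where
  "contains_2314 n h w \<longleftrightarrow>
     (\<exists>i\<in>{1..n}. \<exists>j\<in>{1..n}. \<exists>k\<in>{1..n}. \<exists>l\<in>{1..n}.
        w k < w i \<and> w i < w j \<and> w j < w l \<and>
        i < j \<and> j < k \<and> k < l \<and> l \<le> h j \<and> k \<le> h i \<and> h i < l)"

definition contains_2413 :: "nat \<Rightarrow> (nat \<Rightarrow> nat) \<Rightarrow> (nat \<Rightarrow> nat) \<Rightarrow> bool" where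
  "contains_2413 n h w \<longleftrightarrow>
     (\<exists>i\<in>{1..n}. \<exists>j\<in>{1..n}. \<exists>k\<in>{1..n}. \<exists>l\<in>{1..n}.
        w k < w i \<and> w i < w l \<and> w l < w j \<and>
        i < j \<and> j \<le> h i \<and> h i < k \<and> k \<le> h j \<and> h j < l \<and> l \<le> h k)"

end

theory Submission
  imports Defs
begin

text \<open>
  Write \<open>\<mu> i = min {w 1, \<dots>, w i}\<close> and \<open>M j = max {w j, \<dots>, w n}\<close>. Following the values \<open>v, v + 1, \<dots>\<close>
  of a generator, consecutive values that move to the right do so within the reach of \<open>h\<close>. Hence a
  chain of values that jumps over a window contains a local jump, and the seven associated patterns
  already exclude 2143 and 1324 everywhere, as well as some patterns of length three and four with
  entries beyond the reach of \<open>h\<close>.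

  Since \<open>w\<close> avoids 2143 and 1324, the interval \<open>[w, w0]\<close> consists of the permutations \<open>u\<close> with
  \<open>\<mu> i \<le> u i \<le> M i\<close> for all \<open>i\<close>. Thus the pair \<open>i < j \<le> h i\<close> does not give an edge at \<open>u\<close> iff
  \<open>u j < \<mu> i\<close> or \<open>u i > M j\<close>. The number of pairs of the first kind is independent of \<open>u\<close> for each \<open>i\<close>,
  that of the second kind for each \<open>j\<close>. The pairs of both kinds are counted according to
  \<open>(\<mu> i, M j)\<close>, where they are either all pairs or none, or form a product of two sets of constant
  size.
\<close>

section \<open>Bruhat order and rank conditions\<close>

text \<open>\<open>\<phi>\<close> injects the inversions of v into those of the swapped permutation
  other than (a, b). An inversion moves along with the transposition unless this reverses its two
  positions; then it is kept. The reversed ones have left end a or right end b, and they remain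
  inversions because v a < v b.\<close>

lemma inversions_swap_less:
  assumes ab: "1 \<le> a" "a < b" "b \<le> n" and less: "v a < v b"
  shows "inversions n v < inversions n (swap_positions v a b)"
proof -
  define t where "t = transpose a b"
  have tt: "t (t i) = i" for i by (simp add: t_def)
  have ta: "t a = b" and tb: "t b = a" and to: "i \<noteq> a \<Longrightarrow> i \<noteq> b \<Longrightarrow> t i = i" for i
    by (auto simp: t_def transpose_def)
  have rng: "1 \<le> t i \<and> t i \<le> n" if "1 \<le> i" "i \<le> n" for i
    using that ab by (auto simp: t_def transpose_def)
  define S where "S u = {(i, j). 1 \<le> i \<and> i < j \<and> j \<le> n \<and> (u j :: nat) < u i}" for u
  have fin: "finite (S u)" for u
    by (rule finite_subset[of _ "{1..n} \<times> {1..n}"]) (auto simp: S_def)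
  define \<phi> where "\<phi> = (\<lambda>(i, j). if t i < t j then (t i, t j) else (i, j))"
  have v': "swap_positions v a b i = v (t i)" for i by (simp add: swap_positions_def t_def)
  have twist: "i = a \<and> j < b \<or> j = b \<and> a < i"
    if "(i, j) \<in> S v" "\<not> t i < t j" for i j
  proof -
    have "i < j" "v j < v i" using that by (auto simp: S_def)
    then show ?thesis
      using that(2) ta tb to[of i] to[of j] ab less
      by (cases "i = a"; cases "i = b"; cases "j = a"; cases "j = b") auto
  qed
  have "\<phi> ` S v \<subseteq> S (swap_positions v a b) - {(a, b)}"
  proof clarify
    fix x y i j assume ij: "(i, j) \<in> S v" and xy: "(x, y) = \<phi> (i, j)"
    have *: "1 \<le> i" "i < j" "j \<le> n" "v j < v i" using ij by (auto simp: S_def)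
    show "(x, y) \<in> S (swap_positions v a b) - {(a, b)}"
    proof (cases "t i < t j")
      case True
      have "(t i, t j) \<noteq> (a, b)" using tt[of i] tt[of j] ta tb * ab by auto
      moreover have "(t i, t j) \<in> S (swap_positions v a b)"
        using True * rng[of i] rng[of j] by (auto simp: S_def v' tt)
      ultimately show ?thesis using xy True by (simp add: \<phi>_def)
    next
      case False
      have "(i, j) \<in> S (swap_positions v a b)"
        using twist[OF ij False] * less ta tb to[of i] to[of j] by (auto simp: S_def v')
      moreover have "(i, j) \<noteq> (a, b)" using * less by auto
      ultimately show ?thesis using xy False by (simp add: \<phi>_def)
    qed
  qed
  moreover have "inj_on \<phi> (S v)"
  proof (rule inj_onI, clarify)
    fix i j i' j' assume S: "(i, j) \<in> S v" "(i', j') \<in> S v" and eq: "\<phi> (i, j) = \<phi> (i', j')"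
    have "i < j" "i' < j'" using S by (auto simp: S_def)
    moreover have "x = y" if "t x = t y" for x y using that tt by metis
    \<comment> \<open>A moved pair never equals a kept one: applying t to it returns the increasing
      pair i < j, whereas t reverses kept pairs.\<close>
    ultimately show "i = i' \<and> j = j'"
      using eq by (auto simp: \<phi>_def tt split: if_splits)
  qed
  ultimately have "card (S v) \<le> card (S (swap_positions v a b) - {(a, b)})"
    using fin by (metis card_image card_mono finite_Diff)
  moreover have "(a, b) \<in> S (swap_positions v a b)"
    using ab less by (simp add: S_def v' ta tb)
  ultimately have "card (S v) < card (S (swap_positions v a b))"
    using fin by (metis card_Diff1_less order.strict_trans1)
  then show ?thesis by (simp add: inversions_def S_def)
qed

lemma swap_positions_swap [simp]: "swap_positions (swap_positions u i j) i j = u"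
  by (simp add: swap_positions_def comp_assoc)

lemma swap_positions_apply:
  "swap_positions u i j k = (if k = i then u j else if k = j then u i else u k)"
  by (simp add: swap_positions_def transpose_def)

lemma swap_positions_permutes:
  "u permutes {1..n} \<Longrightarrow> i \<in> {1..n} \<Longrightarrow> j \<in> {1..n} \<Longrightarrow> swap_positions u i j permutes {1..n}"
  unfolding swap_positions_def by (intro permutes_compose permutes_swap_id)

lemma bruhat_step_iff:
  assumes "u permutes {1..n}"
  shows "bruhat_step n u v \<longleftrightarrow>
    (\<exists>i j. 1 \<le> i \<and> i < j \<and> j \<le> n \<and> u i < u j \<and> v = swap_positions u i j)"
proof -
  have "u i < u j \<longleftrightarrow> inversions n u < inversions n (swap_positions u i j)"
    if "1 \<le> i" "i < j" "j \<le> n" for i j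
  proof
    show "u i < u j \<Longrightarrow> inversions n u < inversions n (swap_positions u i j)"
      using that by (rule inversions_swap_less)
    assume *: "inversions n u < inversions n (swap_positions u i j)"
    have "u i \<noteq> u j" using permutes_inj[OF assms] that by (auto dest: injD)
    \<comment> \<open>Otherwise u arises from the swapped permutation by a swap that adds
      inversions.\<close>
    moreover have "\<not> u j < u i"
      using * inversions_swap_less[of i j n "swap_positions u i j"] that
      by (auto simp: swap_positions_apply)
    ultimately show "u i < u j" by linarith
  qed
  then show ?thesis
    using assms by (auto simp: bruhat_step_def symmetric_group_def)
qed

section \<open>Corner ranks of the permutation matrix and the rank criterion for Bruhat
  order\<close>

definition rank_count :: "(nat \<Rightarrow> nat) \<Rightarrow> nat \<Rightarrow> nat \<Rightarrow> nat" where
  "rank_count u p q = card {i \<in> {1..p}. q \<le> u i}"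

lemma rank_count_swap:
  assumes "1 \<le> a" "a < b" and "u b < u a"
  shows "rank_count u p q \<le>
    rank_count (swap_positions u a b) p q + (if a \<le> p \<and> p < b \<and> u b < q \<and> q \<le> u a then 1 else 0)"
proof -
  let ?u = "swap_positions u a b"
  let ?A = "{i \<in> {1..p}. q \<le> u i}" and ?B = "{i \<in> {1..p}. q \<le> ?u i}"
  consider "p < a" | "b \<le> p" | "a \<le> p" "p < b" by linarith
  then show ?thesis
  proof cases
    case 1
    then have "?A = ?B" using assms by (auto simp: swap_positions_apply)
    then show ?thesis by (simp add: rank_count_def)
  next
    case 2
    have "transpose a b ` ?A \<subseteq> ?B"
      using assms 2 by (auto simp: swap_positions_def) (auto simp: transpose_def)
    then have "card (transpose a b ` ?A) \<le> card ?B" by (intro card_mono) auto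
    then have "card ?A \<le> card ?B" by (simp add: card_image)
    then show ?thesis by (simp add: rank_count_def)
  next
    case 3
    show ?thesis
    proof (cases "u b < q \<and> q \<le> u a")
      case True
      have "?A - {a} \<subseteq> ?B" using 3 by (auto simp: swap_positions_apply)
      then have "card (?A - {a}) \<le> card ?B" by (intro card_mono) auto
      moreover have "Suc (card (?A - {a})) = card ?A"
        using True 3 assms by (intro card.remove[symmetric]) auto
      ultimately show ?thesis using True 3 by (simp add: rank_count_def)
    next
      case False
      have "?A \<subseteq> ?B" using 3 False assms by (auto simp: swap_positions_apply)
      then show ?thesis using False by (auto simp: rank_count_def intro!: card_mono)
    qed
  qed
qed

lemma rank_count_split:
  assumes "c \<le> q"
  shows "rank_count u p c = rank_count u p q + card {i \<in> {1..p}. c \<le> u i \<and> u i < q}"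
proof -
  have "{i \<in> {1..p}. c \<le> u i} = {i \<in> {1..p}. q \<le> u i} \<union> {i \<in> {1..p}. c \<le> u i \<and> u i < q}"
    using assms by auto
  then show ?thesis
    unfolding rank_count_def by (simp add: card_Un_disjoint disjoint_iff)
qed

text \<open>
  At the first position \<open>a\<close> where \<open>u\<close> and \<open>w\<close> differ, exchange \<open>u a\<close> with the next entry of \<open>u\<close>
  whose value lies in \<open>[w a, u a)\<close>: this keeps \<open>u\<close> above \<open>w\<close>.
\<close>

lemma bruhat_le_if_rank_count_le:
  assumes "w permutes {1..n}" "u permutes {1..n}"
    and "\<And>p q. p \<le> n \<Longrightarrow> rank_count w p q \<le> rank_count u p q"
  shows "bruhat_le n w u"
  using assms(2,3)
proof (induction "inversions n u" arbitrary: u rule: less_induct)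
  case less
  note u = less.prems(1) and dom = less.prems(2)
  show ?case
  proof (cases "u = w")
    case True
    then show ?thesis by (simp add: bruhat_le_def)
  next
    case False
    then obtain a0 where "u a0 \<noteq> w a0" by auto
    define a where "a = (LEAST i. u i \<noteq> w i)"
    have ua: "u a \<noteq> w a" unfolding a_def by (rule LeastI) fact
    have pre: "u i = w i" if "i < a" for i using that not_less_Least a_def by blast
    have a: "1 \<le> a" "a \<le> n"
      using ua permutes_not_in[OF assms(1), of a] permutes_not_in[OF u, of a] by fastforce+
    \<comment> \<open>Before a the two permutations agree, so a smaller entry of u at a would
      violate \<open>dom\<close> at the corner (a, w a).\<close>
    have "w a < u a"
    proof (rule ccontr)
      assume "\<not> w a < u a"
      then have "u a < w a" using ua by simp
      have "{i \<in> {1..a}. w a \<le> u i} \<subseteq> {i \<in> {1..a}. w a \<le> w i} - {a}"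
      proof
        fix i assume i: "i \<in> {i \<in> {1..a}. w a \<le> u i}"
        then have "i \<noteq> a" using \<open>u a < w a\<close> by auto
        then show "i \<in> {i \<in> {1..a}. w a \<le> w i} - {a}" using i pre[of i] by simp
      qed
      moreover have "a \<in> {i \<in> {1..a}. w a \<le> w i}" using a by simp
      ultimately have "{i \<in> {1..a}. w a \<le> u i} \<subset> {i \<in> {1..a}. w a \<le> w i}" by blast
      then have "rank_count u a (w a) < rank_count w a (w a)"
        unfolding rank_count_def by (intro psubset_card_mono) auto
      then show False using dom[of a "w a"] a by simp
    qed
    have "w a \<in> {1..n}" using permutes_in_image[OF assms(1), of a] a by simp
    then obtain b0 where b0: "b0 \<in> {1..n}" "u b0 = w a"
      using permutes_image[OF u] by (metis image_iff)
    define P where "P = (\<lambda>b. a < b \<and> w a \<le> u b \<and> u b < u a)"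
    have "b0 \<noteq> a" using b0 ua by auto
    moreover have "\<not> b0 < a"
      using pre[of b0] b0 permutes_inj[OF assms(1)] by (auto dest: injD)
    ultimately have "P b0" using b0 \<open>w a < u a\<close> by (simp add: P_def)
    define b where "b = (LEAST b. P b)"
    have "P b" unfolding b_def by (rule LeastI) fact
    have bmin: "\<not> P i" if "i < b" for i using that not_less_Least b_def by blast
    have "b \<le> b0" unfolding b_def by (rule Least_le) fact
    then have b: "a < b" "b \<le> n" "w a \<le> u b" "u b < u a"
      using \<open>P b\<close> b0 by (auto simp: P_def)
    define u' where "u' = swap_positions u a b"
    have u': "u' permutes {1..n}"
      unfolding u'_def using a b by (intro swap_positions_permutes u) auto
    have uu': "u = swap_positions u' a b" by (simp add: u'_def)
    have u'ab: "u' a < u' b" using b by (simp add: u'_def swap_positions_apply)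
    have "rank_count w p q \<le> rank_count u' p q" if "p \<le> n" for p q
    proof (cases "a \<le> p \<and> p < b \<and> u b < q \<and> q \<le> u a")
      case True
      \<comment> \<open>This is the only case in which the swap lowers a count of u. By minimality
        of b, the entries of u in the first p positions with values in [w a, q) all lie before a,
        where u agrees with w; but w also has such an entry at a. Hence \<open>dom\<close> at the
        threshold w a is strict at q, and one entry may be lost.\<close>
      have "{i \<in> {1..p}. w a \<le> u i \<and> u i < q} \<subset> {i \<in> {1..p}. w a \<le> w i \<and> w i < q}"
      proof
        show "{i \<in> {1..p}. w a \<le> u i \<and> u i < q} \<subseteq> {i \<in> {1..p}. w a \<le> w i \<and> w i < q}"
        proof clarify
          fix i assume i: "i \<in> {1..p}" "w a \<le> u i" "u i < q"
          then have "\<not> P i" using bmin[of i] True by auto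
          then have "i < a" using i True by (cases i a rule: linorder_cases) (auto simp: P_def)
          then show "w a \<le> w i \<and> w i < q" using i pre[of i] by simp
        qed
        have "a \<in> {i \<in> {1..p}. w a \<le> w i \<and> w i < q}" using True a b by simp
        moreover have "a \<notin> {i \<in> {1..p}. w a \<le> u i \<and> u i < q}" using True by simp
        ultimately show "{i \<in> {1..p}. w a \<le> u i \<and> u i < q} \<noteq> {i \<in> {1..p}. w a \<le> w i \<and> w i < q}"
          by blast
      qed
      then have "card {i \<in> {1..p}. w a \<le> u i \<and> u i < q} < card {i \<in> {1..p}. w a \<le> w i \<and> w i < q}"
        by (intro psubset_card_mono) auto
      moreover have "w a \<le> q" using True b by simp
      ultimately have "rank_count w p q < rank_count u p q"
        using dom[OF that, of "w a"] rank_count_split[of "w a" q w p] rank_count_split[of "w a" q u p]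
        by simp
      then show ?thesis
        using rank_count_swap[of a b u p q] a b True by (simp add: u'_def)
    next
      case False
      then show ?thesis
        using rank_count_swap[of a b u p q] a b dom[OF that, of q]
        unfolding u'_def by (simp split: if_splits)
    qed
    moreover have "inversions n u' < inversions n u"
      using inversions_swap_less[of a b n u'] a b u'ab uu' by simp
    ultimately have "bruhat_le n w u'" using less.hyps u' by blast
    moreover have "bruhat_step n u' u"
      using bruhat_step_iff[OF u'] a b u'ab uu' by blast
    ultimately show ?thesis by (simp add: bruhat_le_def)
  qed
qed

section \<open>Upper Bruhat intervals as boards\<close>

lemma rank_count_Suc_pos:
  "rank_count u (Suc p) q = rank_count u p q + (if q \<le> u (Suc p) then 1 else 0)"
proof -
  have "{i \<in> {1..Suc p}. q \<le> u i} =
    (if q \<le> u (Suc p) then insert (Suc p) {i \<in> {1..p}. q \<le> u i} else {i \<in> {1..p}. q \<le> u i})"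
    by (auto simp: le_Suc_eq)
  then show ?thesis by (simp add: rank_count_def)
qed

lemma rank_count_Suc_val:
  "rank_count u p q = rank_count u p (Suc q) + card {i \<in> {1..p}. u i = q}"
proof -
  have "{i \<in> {1..p}. q \<le> u i \<and> u i < Suc q} = {i \<in> {1..p}. u i = q}" by auto
  then show ?thesis using rank_count_split[of q "Suc q" u p] by simp
qed

lemma card_values_permutes:
  assumes "u permutes {1..n}" "A \<subseteq> {1..n}"
  shows "card {i \<in> {1..n}. u i \<in> A} = card A"
proof -
  have "A \<subseteq> u ` {1..n}" using permutes_image[OF assms(1)] assms(2) by simp
  then have "u ` {i \<in> {1..n}. u i \<in> A} = A" by blast
  then show ?thesis
    by (metis card_image inj_on_subset permutes_inj assms(1) subset_UNIV)
qed

lemma rank_count_full: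
  assumes "u permutes {1..n}" "1 \<le> q"
  shows "rank_count u n q = n + 1 - q"
proof -
  have "{i \<in> {1..n}. q \<le> u i} = {i \<in> {1..n}. u i \<in> {q..n}}"
    using permutes_in_image[OF assms(1)] by (metis (no_types, lifting) atLeastAtMost_iff)
  then show ?thesis
    using card_values_permutes[OF assms(1), of "{q..n}"] assms(2) by (simp add: rank_count_def)
qed

lemma rank_count_le: "rank_count u p q \<le> p"
  unfolding rank_count_def by (rule order_trans[OF card_mono[of "{1..p}"]]) auto

lemma rank_count_mono: "p \<le> p' \<Longrightarrow> rank_count u p q \<le> rank_count u p' q"
  unfolding rank_count_def by (intro card_mono) auto

lemma longest_perm_permutes: "longest_perm n permutes {1..n}"
  by (rule bij_imp_permutes, rule bij_betw_byWitness[where f' = "longest_perm n"])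
     (auto simp: longest_perm_def)

lemma bruhat_le_longest_perm:
  assumes "u permutes {1..n}"
  shows "bruhat_le n u (longest_perm n)"
proof (rule bruhat_le_if_rank_count_le[OF assms longest_perm_permutes])
  fix p q assume p: "p \<le> n"
  \<comment> \<open>The longest permutation attains the bound min p (n + 1 - q), which no
    permutation exceeds. For q = 0 this minimum is p.\<close>
  have "{1..min p (n + 1 - q)} \<subseteq> {i \<in> {1..p}. q \<le> longest_perm n i}"
    using p by (auto simp: longest_perm_def)
  then have "card {1..min p (n + 1 - q)} \<le> rank_count (longest_perm n) p q"
    unfolding rank_count_def by (intro card_mono) auto
  moreover have "rank_count u p q \<le> min p (n + 1 - q)"
    using rank_count_le[of u p q] rank_count_mono[OF p, of u q] rank_count_full[OF assms, of q] p
    by (cases "q = 0") auto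
  ultimately show "rank_count u p q \<le> rank_count (longest_perm n) p q"
    unfolding card_atLeastAtMost by linarith
qed

section \<open>The board cut out by prefix minima and suffix maxima\<close>

definition prefix_min :: "(nat \<Rightarrow> nat) \<Rightarrow> nat \<Rightarrow> nat" where
  "prefix_min w i = Min (w ` {1..i})"

definition suffix_max :: "nat \<Rightarrow> (nat \<Rightarrow> nat) \<Rightarrow> nat \<Rightarrow> nat" where
  "suffix_max n w j = Max (w ` {j..n})"

text \<open>Rook placements on a skew shape: both borders are weakly decreasing in the
  position.\<close>

definition in_board :: "nat \<Rightarrow> (nat \<Rightarrow> nat) \<Rightarrow> (nat \<Rightarrow> nat) \<Rightarrow> bool" where
  "in_board n w u \<longleftrightarrow> u permutes {1..n} \<and>
     (\<forall>i\<in>{1..n}. prefix_min w i \<le> u i \<and> u i \<le> suffix_max n w i)"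

lemma prefix_min_le: "1 \<le> k \<Longrightarrow> k \<le> i \<Longrightarrow> prefix_min w i \<le> w k"
  by (simp add: prefix_min_def)

lemma prefix_min_attained:
  assumes "1 \<le> i"
  obtains k where "1 \<le> k" "k \<le> i" "w k = prefix_min w i"
proof -
  have "prefix_min w i \<in> w ` {1..i}" unfolding prefix_min_def using assms by (intro Min_in) auto
  then show ?thesis using that by auto
qed

lemma suffix_max_ge: "j \<le> l \<Longrightarrow> l \<le> n \<Longrightarrow> w l \<le> suffix_max n w j"
  by (simp add: suffix_max_def)

lemma suffix_max_attained:
  assumes "j \<le> n"
  obtains l where "j \<le> l" "l \<le> n" "w l = suffix_max n w j"
proof -
  have "suffix_max n w j \<in> w ` {j..n}" unfolding suffix_max_def using assms by (intro Max_in) auto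
  then show ?thesis using that by auto
qed

lemma prefix_min_antimono: "1 \<le> i \<Longrightarrow> i \<le> j \<Longrightarrow> prefix_min w j \<le> prefix_min w i"
  unfolding prefix_min_def by (intro Min_antimono image_mono) auto

lemma suffix_max_antimono: "i \<le> j \<Longrightarrow> j \<le> n \<Longrightarrow> suffix_max n w j \<le> suffix_max n w i"
  unfolding suffix_max_def by (intro Max_mono image_mono) auto

lemma in_board_self: "w permutes {1..n} \<Longrightarrow> in_board n w w"
  by (simp add: in_board_def prefix_min_le suffix_max_ge)

text \<open>As both borders decrease, the other two constraints on the swapped permutation,
  \<open>prefix_min w j \<le> u i\<close> and \<open>u j \<le> suffix_max n w i\<close>, are
  inherited from u.\<close>

lemma in_board_swap_iff:
  assumes u: "in_board n w u" and "1 \<le> i" "i < j" "j \<le> n"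
  shows "in_board n w (swap_positions u i j) \<longleftrightarrow> prefix_min w i \<le> u j \<and> u i \<le> suffix_max n w j"
proof
  assume "in_board n w (swap_positions u i j)"
  then have "prefix_min w i \<le> swap_positions u i j i" "swap_positions u i j j \<le> suffix_max n w j"
    using assms(2-4) by (auto simp: in_board_def)
  then show "prefix_min w i \<le> u j \<and> u i \<le> suffix_max n w j"
    using assms(3) by (simp add: swap_positions_apply)
next
  assume *: "prefix_min w i \<le> u j \<and> u i \<le> suffix_max n w j"
  have "prefix_min w i \<le> u i" "u j \<le> suffix_max n w j"
    using u assms(2-4) by (auto simp: in_board_def)
  then have "prefix_min w j \<le> u i" "u j \<le> suffix_max n w i"
    using prefix_min_antimono[of i j w] suffix_max_antimono[of i j n w] assms(2-4) by linarith+
  then show "in_board n w (swap_positions u i j)"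
    using u * assms(2-4) swap_positions_permutes[of u n i j]
    by (auto simp: in_board_def swap_positions_apply)
qed

text \<open>A Bruhat step exchanges entries u i < u j, so the entry at i grows and the entry at j
  drops; the bounds to be checked follow from those of u.\<close>

lemma in_board_if_bruhat_le:
  assumes "w permutes {1..n}" "bruhat_le n w u"
  shows "in_board n w u"
  using assms(2) unfolding bruhat_le_def
proof (induction rule: rtranclp_induct)
  case base
  then show ?case by (rule in_board_self) fact
next
  case (step u v)
  have "u permutes {1..n}" using step.IH by (simp add: in_board_def)
  from bruhat_step_iff[OF this] step.hyps(2) obtain i j where
    ij: "1 \<le> i" "i < j" "j \<le> n" "u i < u j" "v = swap_positions u i j" by blast
  have "prefix_min w i \<le> u i" "u j \<le> suffix_max n w j"
    using step.IH ij by (auto simp: in_board_def)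
  then have "prefix_min w i \<le> u j" "u i \<le> suffix_max n w j" using ij by linarith+
  then show ?case using in_board_swap_iff[OF step.IH] ij by blast
qed

section \<open>From the board back to Bruhat order\<close>

definition pattern_2143_free :: "nat \<Rightarrow> (nat \<Rightarrow> nat) \<Rightarrow> bool" where
  "pattern_2143_free n w \<longleftrightarrow> (\<forall>i j k l. 1 \<le> i \<longrightarrow> i < j \<longrightarrow> j < k \<longrightarrow> k < l \<longrightarrow> l \<le> n \<longrightarrow>
     \<not> (w j < w i \<and> w i < w l \<and> w l < w k))"

definition pattern_1324_free :: "nat \<Rightarrow> (nat \<Rightarrow> nat) \<Rightarrow> bool" where
  "pattern_1324_free n w \<longleftrightarrow> (\<forall>i j k l. 1 \<le> i \<longrightarrow> i < j \<longrightarrow> j < k \<longrightarrow> k < l \<longrightarrow> l \<le> n \<longrightarrow>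
     \<not> (w i < w k \<and> w k < w j \<and> w j < w l))"

text \<open>
  The point \<open>(p, q)\<close> is in Fulton's essential set of \<open>w\<close>. If \<open>w\<close> avoids 2143 and 1324, the rank
  condition there is an inclusion.
\<close>

lemma essential_point_trivial:
  assumes w: "w permutes {1..n}" and av: "pattern_2143_free n w" "pattern_1324_free n w"
    and p: "1 \<le> p" "p < n" and q: "w k1 = q" "w k2 = q - 1" "1 < q"
    and k1: "1 \<le> k1" "k1 \<le> p" and k2: "p < k2" "k2 \<le> n"
    and ess: "q \<le> w p" "w (Suc p) < q"
    and x: "1 \<le> x" "x \<le> p" "w x < q" and y: "p < y" "y \<le> n" "q \<le> w y"
  shows False
proof -
  have inj: "w i = w j \<longleftrightarrow> i = j" for i j using permutes_inj[OF w] by (auto dest: injD)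
  note A = av(1)[unfolded pattern_2143_free_def, rule_format]
    and B = av(2)[unfolded pattern_1324_free_def, rule_format]
  have "x \<noteq> k1" "x \<noteq> k2" "y \<noteq> k1" "y \<noteq> k2" "y \<noteq> Suc p" "x \<noteq> p"
    using q x y k1 k2 ess by auto
  then have "w x \<noteq> q - 1" "w y \<noteq> q" using inj q by metis+
  then have wx: "w x < q - 1" and wy: "q < w y" using x y by linarith+
  have "y > Suc p" "x < p" using x y \<open>y \<noteq> Suc p\<close> \<open>x \<noteq> p\<close> by linarith+
  \<comment> \<open>The value q lies left of the cut after p and q - 1 right of it, and w descends
    through q at the cut. With the small entry x on the left and the large entry y on the right,
    every relative order produces 1324 or 2143.\<close>
  consider "x < k1" "k2 < y" | "x < k1" "y < k2" | "k1 < x"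
    using \<open>x \<noteq> k1\<close> \<open>y \<noteq> k2\<close> by linarith
  then show False
  proof cases
    case 1
    then show False using B[of x k1 k2 y] wx wy q x y k1 k2 by linarith
  next
    case 2
    have "w (Suc p) \<noteq> w x" using inj \<open>x < p\<close> by simp
    then consider "w (Suc p) < w x" | "w x < w (Suc p)" by linarith
    then show False
    proof cases
      case 1
      then show False
        using A[of x "Suc p" y k2] wx wy q x y k2 2 \<open>y > Suc p\<close> by linarith
    next
      case 2
      then show False
        using B[of x k1 "Suc p" y] wy q x y k1 ess \<open>x < k1\<close> \<open>y > Suc p\<close> by linarith
    qed
  next
    case 3
    have "w (Suc p) \<noteq> w x" "w y \<noteq> w p" using inj \<open>x < p\<close> \<open>p < y\<close> by simp_all
    then consider "w y < w p" | "w p < w y" "k2 < y"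
      | "w p < w y" "y < k2" "w (Suc p) < w x" | "w p < w y" "w x < w (Suc p)"
      using \<open>y \<noteq> k2\<close> by linarith
    then show False
    proof cases
      case 1
      then show False using A[of k1 x p y] 3 wy q x y k1 \<open>x < p\<close> by linarith
    next
      case 2
      then show False using B[of x p k2 y] wx q x y k2 ess \<open>x < p\<close> by linarith
    next
      case 3
      then show False using A[of x "Suc p" y k2] wx wy q x k2 \<open>y > Suc p\<close> by linarith
    next
      case 4
      then show False using B[of x p "Suc p" y] x y ess \<open>x < p\<close> \<open>y > Suc p\<close> by linarith
    qed
  qed
qed

text \<open>
  A violated rank condition is pushed to the essential set by maximising \<open>rank_count w\<close> first
  and \<open>q - p\<close> second.
\<close>

lemma bruhat_le_if_in_board:
  assumes w: "w permutes {1..n}" and av: "pattern_2143_free n w" "pattern_1324_free n w"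
    and board: "in_board n w u"
  shows "bruhat_le n w u"
proof -
  have u: "u permutes {1..n}" using board by (simp add: in_board_def)
  define bad where "bad = (\<lambda>(p, q). p \<le> n \<and> rank_count u p q < rank_count w p q)"
  \<comment> \<open>A unit of rank weighs 2, so each of the four moves tried below increases f: it
    either keeps the rank and gains 1 in q + (n - p), or gains one rank and loses 1 there.\<close>
  define f where "f = (\<lambda>(p, q). 2 * rank_count w p q + q + (n - p))"
  have bad_range: "1 \<le> p \<and> p < n \<and> 1 < q \<and> q \<le> n" if "bad (p, q)" for p q
  proof -
    have lt: "rank_count u p q < rank_count w p q" and "p \<le> n" using that by (auto simp: bad_def)
    have "p \<noteq> 0" using lt rank_count_le[of w p q] by auto
    have "1 < q"
    proof (rule ccontr)
      assume "\<not> 1 < q"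
      have "q \<le> u i" if "i \<in> {1..p}" for i
        using that \<open>\<not> 1 < q\<close> \<open>p \<le> n\<close> permutes_in_image[OF u, of i] by auto
      then have "{i \<in> {1..p}. q \<le> u i} = {1..p}" by blast
      then have "rank_count u p q = p" by (simp add: rank_count_def)
      then show False using lt rank_count_le[of w p q] by simp
    qed
    moreover have "rank_count w p q \<le> n + 1 - q"
      using rank_count_mono[OF \<open>p \<le> n\<close>, of w q] rank_count_full[OF w, of q] \<open>1 < q\<close> by simp
    moreover have "p \<noteq> n"
      using lt rank_count_full[OF w, of q] rank_count_full[OF u, of q] \<open>1 < q\<close> by auto
    ultimately show ?thesis using lt \<open>p \<noteq> 0\<close> \<open>1 < q\<close> \<open>p \<le> n\<close> by linarith
  qed
  have none_bad: "\<not> bad pq" for pq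
  proof
    assume "bad pq"
    have bound: "\<forall>y. bad y \<longrightarrow> f y < 4 * n + 1"
    proof clarify
      fix p q assume "bad (p, q)"
      from bad_range[OF this] rank_count_le[of w p q]
      have "rank_count w p q \<le> n" "q \<le> n" by linarith+
      then show "f (p, q) < 4 * n + 1" unfolding f_def prod.case by linarith
    qed
    obtain x where "bad x" and max: "\<And>y. bad y \<Longrightarrow> f y \<le> f x"
      using ex_has_greatest_nat[OF \<open>bad pq\<close> bound] by auto
    obtain p q where x: "x = (p, q)" by force
    note b = \<open>bad x\<close>[unfolded x] and max = max[unfolded x]
    note rg = bad_range[OF b]
    have lt: "rank_count u p q < rank_count w p q" using b by (simp add: bad_def)
    have "w (Suc p) < q"
    proof (rule ccontr)
      assume "\<not> w (Suc p) < q"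
      then have "bad (Suc p, q)" "f (Suc p, q) > f (p, q)"
        using lt rg by (auto simp: bad_def f_def rank_count_Suc_pos)
      then show False using max[of "(Suc p, q)"] by simp
    qed
    obtain p' where p': "p = Suc p'" using rg by (cases p) auto
    have "q \<le> w p"
    proof (rule ccontr)
      assume "\<not> q \<le> w p"
      then have "bad (p', q)" "f (p', q) > f (p, q)"
        using lt rg by (simp_all add: p' bad_def f_def rank_count_Suc_pos split: if_splits)
      then show False using max[of "(p', q)"] by simp
    qed
    obtain k1 where k1: "k1 \<in> {1..n}" "w k1 = q"
      using rg permutes_image[OF w] by (metis atLeastAtMost_iff imageE less_imp_le_nat)
    have "q - 1 \<in> w ` {1..n}" using rg permutes_image[OF w] by auto
    then obtain k2 where k2: "k2 \<in> {1..n}" "w k2 = q - 1" by auto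
    have inj: "w i = w j \<longleftrightarrow> i = j" for i j using permutes_inj[OF w] by (auto dest: injD)
    have "k1 \<le> p"
    proof (rule ccontr)
      assume "\<not> k1 \<le> p"
      then have "{i \<in> {1..p}. w i = q} = {}" using k1 inj by auto
      then have "rank_count w p (Suc q) = rank_count w p q"
        using rank_count_Suc_val[of w p q] by (simp only:) simp
      moreover have "rank_count u p (Suc q) \<le> rank_count u p q"
        using rank_count_Suc_val[of u p q] by simp
      ultimately have "bad (p, Suc q)" "f (p, Suc q) > f (p, q)"
        using lt rg by (auto simp: bad_def f_def)
      then show False using max[of "(p, Suc q)"] by simp
    qed
    have "p < k2"
    proof (rule ccontr)
      assume "\<not> p < k2"
      obtain q' where q': "q = Suc q'" using rg by (cases q) auto
      have "{i \<in> {1..p}. w i = q'} = {k2}" using k2 inj \<open>\<not> p < k2\<close> q' by auto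
      then have "rank_count w p q' = Suc (rank_count w p q)"
        using rank_count_Suc_val[of w p q'] q' by simp
      \<comment> \<open>Lowering q by one raises the rank of w by exactly one, and that of u by at
        most one since u takes the value q' once. So the point stays bad.\<close>
      moreover have "card {i \<in> {1..p}. u i = q'} \<le> card {inv u q'}"
        using permutes_inverses(2)[OF u] by (intro card_mono) auto
      then have "rank_count u p q' \<le> Suc (rank_count u p q)"
        using rank_count_Suc_val[of u p q'] q' by simp
      ultimately have "bad (p, q')" "f (p, q') > f (p, q)"
        using lt rg q' by (auto simp: bad_def f_def)
      then show False using max[of "(p, q')"] by simp
    qed
    \<comment> \<open>Without x, the lower border is at least q on the first p positions, and u has
      full rank p there. Without y (below), the upper border is less than q after p, and u has all
      its values from q on in the first p positions. Either way the rank of u cannot be too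
      small.\<close>
    have "\<exists>x. 1 \<le> x \<and> x \<le> p \<and> w x < q"
    proof (rule ccontr)
      assume none: "\<nexists>x. 1 \<le> x \<and> x \<le> p \<and> w x < q"
      have "q \<le> u i" if "i \<in> {1..p}" for i
      proof -
        have i: "1 \<le> i" "i \<le> p" using that by auto
        obtain k where k: "1 \<le> k" "k \<le> i" "w k = prefix_min w i"
          using prefix_min_attained[OF i(1)] .
        have "prefix_min w i \<le> u i" using board i rg by (simp add: in_board_def)
        moreover have "q \<le> w k" using none k i by (meson le_trans not_le)
        ultimately show ?thesis using k by linarith
      qed
      then have "{i \<in> {1..p}. q \<le> u i} = {1..p}" by blast
      then show False using lt rank_count_le[of w p q] by (simp add: rank_count_def)
    qed
    then obtain x where x: "1 \<le> x" "x \<le> p" "w x < q" by blast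
    have "\<exists>y. p < y \<and> y \<le> n \<and> q \<le> w y"
    proof (rule ccontr)
      assume none: "\<nexists>y. p < y \<and> y \<le> n \<and> q \<le> w y"
      have "i \<le> p" if "i \<in> {1..n}" "q \<le> u i" for i
      proof (rule ccontr)
        assume "\<not> i \<le> p"
        have i: "1 \<le> i" "i \<le> n" using that by auto
        obtain l where l: "i \<le> l" "l \<le> n" "w l = suffix_max n w i"
          using suffix_max_attained[OF i(2)] .
        have "u i \<le> suffix_max n w i" using board i by (simp add: in_board_def)
        have "p < l" using l \<open>\<not> i \<le> p\<close> by linarith
        then have "\<not> q \<le> w l" using none l by blast
        then show False using \<open>u i \<le> suffix_max n w i\<close> l \<open>q \<le> u i\<close> by linarith
      qed
      then have "{i \<in> {1..p}. q \<le> u i} = {i \<in> {1..n}. q \<le> u i}" using rg by auto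
      then have "rank_count u p q = rank_count w n q"
        using rank_count_full[OF u, of q] rank_count_full[OF w, of q] rg
        by (simp add: rank_count_def)
      then show False using lt rank_count_mono[of p n w q] rg by simp
    qed
    then obtain y where y: "p < y" "y \<le> n" "q \<le> w y" by blast
    show False
      using essential_point_trivial[OF w av, of p k1 q k2 x y] rg k1 k2 x y
        \<open>k1 \<le> p\<close> \<open>p < k2\<close> \<open>q \<le> w p\<close> \<open>w (Suc p) < q\<close> by simp
  qed
  have "rank_count w p q \<le> rank_count u p q" if "p \<le> n" for p q
    using that none_bad[of "(p, q)"] by (simp add: bad_def)
  then show ?thesis by (rule bruhat_le_if_rank_count_le[OF w u])
qed

lemma bruhat_interval_longest_perm:
  assumes "w permutes {1..n}" "pattern_2143_free n w" "pattern_1324_free n w"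
  shows "bruhat_interval n w (longest_perm n) = {u. in_board n w u}"
proof (intro equalityI subsetI)
  fix u assume "u \<in> bruhat_interval n w (longest_perm n)"
  then have "bruhat_le n w u" by (simp add: bruhat_interval_def)
  then have "in_board n w u" by (rule in_board_if_bruhat_le[OF assms(1)])
  then show "u \<in> {u. in_board n w u}" by simp
next
  fix u assume "u \<in> {u. in_board n w u}"
  then have u: "in_board n w u" by simp
  then have "u permutes {1..n}" by (simp add: in_board_def)
  then show "u \<in> bruhat_interval n w (longest_perm n)"
    using bruhat_le_if_in_board[OF assms u] bruhat_le_longest_perm[of u n]
    by (simp add: bruhat_interval_def symmetric_group_def)
qed

section \<open>Patterns excluded by the generator condition\<close>

locale avoiding_generator =
  fixes n :: nat and h w :: "nat \<Rightarrow> nat"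
  assumes hessenberg: "hessenberg n h"
    and generator: "is_generator n h w"
    and avoids_2143: "\<not> contains_2143 n h w"
    and avoids_1324: "\<not> contains_1324 n h w"
    and avoids_1243: "\<not> contains_1243 n h w"
    and avoids_2134: "\<not> contains_2134 n h w"
    and avoids_1423: "\<not> contains_1423 n h w"
    and avoids_2314: "\<not> contains_2314 n h w"
    and avoids_2413: "\<not> contains_2413 n h w"
begin

section \<open>Consecutive values of a generator\<close>

lemma w_permutes: "w permutes {1..n}"
  using generator by (simp add: is_generator_def symmetric_group_def)

lemma inj: "w i = w j \<longleftrightarrow> i = j"
  using permutes_inj[OF w_permutes] by (auto dest: injD)

lemma value_in: "1 \<le> i \<Longrightarrow> i \<le> n \<Longrightarrow> 1 \<le> w i \<and> w i \<le> n"
  using permutes_in_image[OF w_permutes, of i] by simp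

lemma position_exists:
  assumes "1 \<le> v" "v \<le> n"
  obtains i where "1 \<le> i" "i \<le> n" "w i = v"
proof -
  have "v \<in> w ` {1..n}" using permutes_image[OF w_permutes] assms by simp
  then show ?thesis using that by auto
qed

lemma h_mono: "1 \<le> i \<Longrightarrow> i \<le> j \<Longrightarrow> j \<le> n \<Longrightarrow> h i \<le> h j"
  using hessenberg mono_onD[of "{1..n}" h i j] by (simp add: hessenberg_def)

lemma h_range: "1 \<le> i \<Longrightarrow> i \<le> n \<Longrightarrow> i \<le> h i \<and> h i \<le> n"
  using hessenberg by (auto simp: hessenberg_def)

text \<open>The generator condition without \<open>inv\<close>: the source of every bound on the
  position of a next value.\<close>

lemma successor_local:
  assumes "1 \<le> a" "a \<le> n" "b \<le> n" "w b = Suc (w a)"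
  shows "b \<le> h a"
proof -
  \<comment> \<open>The number 0 is fixed by w, so a positive value does not sit there.\<close>
  have "1 \<le> b"
    using assms permutes_not_in[OF w_permutes, of 0] by (cases "b = 0") auto
  then have "w a \<le> n - 1" using value_in[of b] assms by linarith
  then have "inv w (w a + 1) \<le> h a"
    using generator assms(1,2) by (simp add: is_generator_def)
  moreover have "inv w (w a + 1) = b"
    using permutes_inverses(2)[OF w_permutes, of b] assms(4) by simp
  ultimately show ?thesis by simp
qed

text \<open>A discrete intermediate value argument: climb through the values w a, w a + 1, ..., w b.
  Somewhere P is lost between two consecutive values, and \<open>successor_local\<close> applies to
  that step.\<close>

lemma crossing:
  assumes "1 \<le> a" "a \<le> n" "1 \<le> b" "b \<le> n" "P a" "\<not> P b" "w a \<le> w b"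
  obtains c d where "1 \<le> c" "c \<le> n" "1 \<le> d" "d \<le> n" "P c" "\<not> P d"
    "w d = Suc (w c)" "w a \<le> w c" "w d \<le> w b" "d \<le> h c"
proof -
  have "\<exists>c d. 1 \<le> c \<and> c \<le> n \<and> 1 \<le> d \<and> d \<le> n \<and> P c \<and> \<not> P d \<and>
    w d = Suc (w c) \<and> w a \<le> w c \<and> w d \<le> w b"
    using assms
  proof (induction "w b - w a" arbitrary: a rule: less_induct)
    case less
    have "w a \<noteq> w b" using inj less.prems by auto
    then have "w a < w b" using less.prems by simp
    then have "1 \<le> Suc (w a)" "Suc (w a) \<le> n" using value_in[of b] less.prems by linarith+
    then obtain e where e: "1 \<le> e" "e \<le> n" "w e = Suc (w a)" by (rule position_exists)
    show ?case
    proof (cases "P e")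
      case True
      have "w b - w e < w b - w a" using e \<open>w a < w b\<close> by linarith
      then obtain c d where "1 \<le> c" "c \<le> n" "1 \<le> d" "d \<le> n" "P c" "\<not> P d"
        "w d = Suc (w c)" "w e \<le> w c" "w d \<le> w b"
        using less.hyps[of e] e less.prems \<open>w a < w b\<close> True by auto
      moreover have "w a \<le> w c" using \<open>w e \<le> w c\<close> e by linarith
      ultimately show ?thesis by blast
    next
      case False
      moreover have "w e \<le> w b" using e \<open>w a < w b\<close> by linarith
      ultimately show ?thesis using e less.prems by blast
    qed
  qed
  then show ?thesis using that successor_local by blast
qed

section \<open>The associated patterns and their variants beyond the reach of h\<close>

lemma no_2143:
  assumes "1 \<le> i" "i < j" "j < k" "k < l" "l \<le> n" "l \<le> h i" "w j < w i" "w i < w l" "w l < w k"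
  shows False
proof -
  have "i \<in> {1..n}" "j \<in> {1..n}" "k \<in> {1..n}" "l \<in> {1..n}" using assms(1-5) by auto
  then show False using avoids_2143 assms unfolding contains_2143_def by blast
qed

lemma no_1324:
  assumes "1 \<le> i" "i < j" "j < k" "k < l" "l \<le> n" "l \<le> h j" "k \<le> h i"
    "w i < w k" "w k < w j" "w j < w l"
  shows False
proof -
  have "i \<in> {1..n}" "j \<in> {1..n}" "k \<in> {1..n}" "l \<in> {1..n}" using assms(1-5) by auto
  then show False using avoids_1324 assms unfolding contains_1324_def by blast
qed

lemma no_1243:
  assumes "1 \<le> i" "i < j" "j < k" "k < l" "l \<le> n" "l \<le> h j" "j \<le> h i" "h i < l"
    "w i < w j" "w j < w l" "w l < w k"
  shows False
proof -
  have "i \<in> {1..n}" "j \<in> {1..n}" "k \<in> {1..n}" "l \<in> {1..n}" using assms(1-5) by auto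
  then show False using avoids_1243 assms unfolding contains_1243_def by blast
qed

lemma no_2134:
  assumes "1 \<le> i" "i < j" "j < k" "k < l" "l \<le> n" "l \<le> h k" "k \<le> h i" "h i < l"
    "w j < w i" "w i < w k" "w k < w l"
  shows False
proof -
  have "i \<in> {1..n}" "j \<in> {1..n}" "k \<in> {1..n}" "l \<in> {1..n}" using assms(1-5) by auto
  then show False using avoids_2134 assms unfolding contains_2134_def by blast
qed

lemma no_1423:
  assumes "1 \<le> i" "i < j" "j < k" "k < l" "l \<le> n" "l \<le> h j" "k \<le> h i" "h i < l"
    "w i < w k" "w k < w l" "w l < w j"
  shows False
proof -
  have "i \<in> {1..n}" "j \<in> {1..n}" "k \<in> {1..n}" "l \<in> {1..n}" using assms(1-5) by auto
  then show False using avoids_1423 assms unfolding contains_1423_def by blast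
qed

lemma no_2314:
  assumes "1 \<le> i" "i < j" "j < k" "k < l" "l \<le> n" "l \<le> h j" "k \<le> h i" "h i < l"
    "w k < w i" "w i < w j" "w j < w l"
  shows False
proof -
  have "i \<in> {1..n}" "j \<in> {1..n}" "k \<in> {1..n}" "l \<in> {1..n}" using assms(1-5) by auto
  then show False using avoids_2314 assms unfolding contains_2314_def by blast
qed

lemma no_2413:
  assumes "1 \<le> i" "i < j" "j \<le> h i" "h i < k" "k \<le> h j" "h j < l" "l \<le> h k" "l \<le> n" "k \<le> n"
    "w k < w i" "w i < w l" "w l < w j"
  shows False
proof -
  have "j < n" "i < n"
    using assms(2,3,4,9) by linarith+
  then have "i \<in> {1..n}" "j \<in> {1..n}" "k \<in> {1..n}" "l \<in> {1..n}"
    using assms(1-9) h_range[of j] by auto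
  then show False using avoids_2413 assms unfolding contains_2413_def by blast
qed

text \<open>The climb from w i to w l leaves the window of i by a step from c to d with d \<le> h c.
  Monotonicity of h forces i < c. If c is before j, then i, c, j, d is an associated 2314, otherwise
  i, j, c, d is an associated 2134.\<close>

lemma no_213_far:
  assumes "1 \<le> i" "i < j" "j \<le> h i" "h i < l" "l \<le> n" "w j < w i" "w i < w l"
  shows False
proof -
  have "i \<le> n" "h i \<le> n" using assms by linarith+
  have pre: "1 \<le> i" "i \<le> n" "1 \<le> l" "l \<le> n" "i \<le> h i" "\<not> l \<le> h i" "w i \<le> w l"
    using assms h_range[of i] \<open>i \<le> n\<close> by simp_all
  obtain c d where cd: "1 \<le> c" "c \<le> n" "1 \<le> d" "d \<le> n" "c \<le> h i" "\<not> d \<le> h i"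
    "w d = Suc (w c)" "w i \<le> w c" "w d \<le> w l" "d \<le> h c"
    by (rule crossing[of i l "\<lambda>x. x \<le> h i", OF pre])
  have "i < c"
  proof (rule ccontr)
    assume "\<not> i < c"
    then show False using cd h_mono[of c i] \<open>i \<le> n\<close> by simp
  qed
  then have "w i < w c" using cd(8) inj[of i c] by simp
  have "c \<noteq> j" using cd assms by auto
  then consider "c < j" | "j < c" by linarith
  then show False
  proof cases
    case 1
    then show False using no_2314[of i c j d] assms cd \<open>i < c\<close> \<open>w i < w c\<close> by linarith
  next
    case 2
    then show False using no_2134[of i j c d] assms cd \<open>w i < w c\<close> by linarith
  qed
qed

text \<open>The reverse-complement counterpart of \<open>no_213_far\<close>: on the climb from w i
  to w k, take a step from a position c that does not reach k to a position d that does. It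
  satisfies c < d < k and c < j. If d is before j, then c, d, j, k is an associated 1243, otherwise
  c, j, d, k is an associated 1423.\<close>

lemma no_132_far:
  assumes "1 \<le> i" "i < j" "j < k" "h i < k" "k \<le> h j" "k \<le> n" "w i < w k" "w k < w j"
  shows False
proof -
  have pre: "1 \<le> i" "i \<le> n" "1 \<le> k" "k \<le> n" "h i < k" "\<not> h k < k" "w i \<le> w k"
    using assms h_range[of k] by simp_all
  obtain c d where cd: "1 \<le> c" "c \<le> n" "1 \<le> d" "d \<le> n" "h c < k" "\<not> h d < k"
    "w d = Suc (w c)" "w i \<le> w c" "w d \<le> w k" "d \<le> h c"
    by (rule crossing[of i k "\<lambda>x. h x < k", OF pre])
  have "c < d"
  proof (rule ccontr)
    assume "\<not> c < d"
    then show False using cd h_mono[of d c] by simp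
  qed
  have "c < j"
  proof (rule ccontr)
    assume "\<not> c < j"
    then show False using cd h_mono[of j c] assms by simp
  qed
  have "d < k" using cd by linarith
  then have "w d < w k" using cd(9) inj[of d k] by simp
  then have "d \<noteq> j" using assms by auto
  then consider "d < j" | "j < d" by linarith
  then show False
  proof cases
    case 1
    then show False using no_1243[of c d j k] assms cd \<open>c < d\<close> \<open>w d < w k\<close> by linarith
  next
    case 2
    then show False using no_1423[of c j d k] assms cd \<open>c < j\<close> \<open>d < k\<close> \<open>w d < w k\<close> by linarith
  qed
qed

text \<open>One climb passes j by a step from c to d within the reach of c, a second one continues
  from w d and leaves the window of j at d'. Either c, j, k, d' is an associated 2413, or k together
  with d' and one of c, d contradicts \<open>no_213_far\<close>.\<close>

lemma no_2413_far_right: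
  assumes "1 \<le> i" "i < j" "j < k" "k \<le> h j" "h j < l" "l \<le> n"
    "w k < w i" "w i < w l" "w l < w j"
  shows False
proof -
  have jn: "j \<le> n" "k \<le> n" using assms h_range[of j] by linarith+
  have pre: "1 \<le> i" "i \<le> n" "1 \<le> l" "l \<le> n" "i < j" "\<not> l < j" "w i \<le> w l"
    using assms jn by simp_all
  obtain c d where cd: "1 \<le> c" "c \<le> n" "1 \<le> d" "d \<le> n" "c < j" "\<not> d < j"
    "w d = Suc (w c)" "w i \<le> w c" "w d \<le> w l" "d \<le> h c"
    by (rule crossing[of i l "\<lambda>x. x < j", OF pre])
  have "d \<noteq> j" using cd assms by auto
  then have "j < d" using cd by linarith
  have "d \<le> h j" using cd h_mono[of c j] jn by simp
  have pre': "1 \<le> d" "d \<le> n" "1 \<le> l" "l \<le> n" "d \<le> h j" "\<not> l \<le> h j" "w d \<le> w l"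
    using assms cd \<open>d \<le> h j\<close> by simp_all
  obtain c' d' where cd': "1 \<le> c'" "c' \<le> n" "1 \<le> d'" "d' \<le> n" "c' \<le> h j" "\<not> d' \<le> h j"
    "w d' = Suc (w c')" "w d \<le> w c'" "w d' \<le> w l" "d' \<le> h c'"
    by (rule crossing[of d l "\<lambda>x. x \<le> h j", OF pre'])
  have "h c \<le> h j" using h_mono[of c j] cd jn by simp
  have "h c < k"
  proof (rule ccontr)
    assume "\<not> h c < k"
    then show False using no_213_far[of c k d'] assms cd cd' \<open>h c \<le> h j\<close> by linarith
  qed
  then have "d < k" using cd by linarith
  have "k \<le> h d" using h_mono[of j d] assms cd \<open>j < d\<close> by simp
  have "d' \<le> h d"
  proof (rule ccontr)
    assume "\<not> d' \<le> h d"
    then show False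
      using no_213_far[of d k d'] assms cd cd' \<open>d < k\<close> \<open>k \<le> h d\<close> by linarith
  qed
  then have "d' \<le> h k" using h_mono[of d k] cd \<open>d < k\<close> jn by linarith
  then show False using no_2413[of c j k d'] assms cd cd' \<open>h c < k\<close> \<open>j < d\<close> jn by linarith
qed

text \<open>Here one climb passes k by a step from c to d, and a second one, from w i to w c,
  provides c' whose window ends before k. Either c', j, k, d is an associated 2413, or c' and j
  together with c or d contradict \<open>no_132_far\<close>.\<close>

lemma no_2413_far_left:
  assumes "1 \<le> i" "i < j" "j < k" "h i < k" "k \<le> h j" "k < l" "l \<le> n"
    "w k < w i" "w i < w l" "w l < w j"
  shows False
proof -
  have jn: "j \<le> n" "k \<le> n" using assms by linarith+
  have pre: "1 \<le> i" "i \<le> n" "1 \<le> l" "l \<le> n" "i < k" "\<not> l < k" "w i \<le> w l"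
    using assms jn by simp_all
  obtain c d where cd: "1 \<le> c" "c \<le> n" "1 \<le> d" "d \<le> n" "c < k" "\<not> d < k"
    "w d = Suc (w c)" "w i \<le> w c" "w d \<le> w l" "d \<le> h c"
    by (rule crossing[of i l "\<lambda>x. x < k", OF pre])
  have "d \<noteq> k" using cd assms by auto
  then have "k < d" using cd by linarith
  have pre': "1 \<le> i" "i \<le> n" "1 \<le> c" "c \<le> n" "h i < k" "\<not> h c < k" "w i \<le> w c"
    using assms cd \<open>k < d\<close> by simp_all
  obtain c' d' where cd': "1 \<le> c'" "c' \<le> n" "1 \<le> d'" "d' \<le> n" "h c' < k" "\<not> h d' < k"
    "w d' = Suc (w c')" "w i \<le> w c'" "w d' \<le> w c" "d' \<le> h c'"
    by (rule crossing[of i c "\<lambda>x. h x < k", OF pre'])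
  have "c' < j"
  proof (rule ccontr)
    assume "\<not> c' < j"
    then show False using cd' h_mono[of j c'] assms by simp
  qed
  have "h j < d"
  proof (rule ccontr)
    assume "\<not> h j < d"
    then show False using no_132_far[of c' j d] assms cd cd' \<open>k < d\<close> \<open>c' < j\<close> by linarith
  qed
  then have "j < c" using cd h_mono[of c j] jn by linarith
  have "c \<le> h c'"
  proof (rule ccontr)
    assume "\<not> c \<le> h c'"
    then show False using no_132_far[of c' j c] assms cd cd' \<open>c' < j\<close> \<open>j < c\<close> by linarith
  qed
  moreover have "h c \<le> h k" using h_mono[of c k] cd jn by simp
  ultimately show False
    using no_2413[of c' j k d] assms cd cd' \<open>c' < j\<close> \<open>j < c\<close> \<open>h j < d\<close> jn by linarith
qed

text \<open>Let b be the position of the value w i + 1. If b is before j or after k, it replaces i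
  or l in an occurrence with a smaller gap. If b = l, the occurrence is local. Otherwise j < b \<le>
  h i brings j into the window of i, and l is either inside the window as well or excluded by
  \<open>no_213_far\<close>.\<close>

lemma globally_no_2143:
  assumes "1 \<le> i" "i < j" "j < k" "k < l" "l \<le> n" "w j < w i" "w i < w l" "w l < w k"
  shows False
  using assms
proof (induction "w l - w i" arbitrary: i l rule: less_induct)
  case less
  note a = less.prems
  have "1 \<le> Suc (w i)" "Suc (w i) \<le> n" using value_in[of l] a by linarith+
  then obtain b where b: "1 \<le> b" "b \<le> n" "w b = Suc (w i)" by (rule position_exists)
  have "b \<le> h i" using successor_local[of i b] b a by simp
  show False
  proof (cases "b = l")
    case True
    then show False using no_2143[of i j k l] a \<open>b \<le> h i\<close> by simp
  next
    case False
    then have "w b < w l" using inj[of b l] b a by simp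
    have dec: "w l - w b < w l - w i" "w b - w i < w l - w i" using b \<open>w b < w l\<close> by linarith+
    have "\<not> b < j"
    proof
      assume "b < j"
      then show False using less.hyps[OF dec(1)] a b \<open>w b < w l\<close> by simp
    qed
    moreover have "\<not> k < b"
    proof
      assume "k < b"
      then show False using less.hyps[OF dec(2)] a b \<open>w b < w l\<close> by simp
    qed
    moreover have "b \<noteq> j" using a b by auto
    ultimately have "j < b" "b \<le> k" by linarith+
    show False
    proof (cases "l \<le> h i")
      case True
      then show False using no_2143[of i j k l] a by simp
    next
      case False
      then show False
        using no_213_far[of i j l] a \<open>j < b\<close> \<open>b \<le> h i\<close> by simp
    qed
  qed
qed

text \<open>In an occurrence with minimal gaps, the position b of w i + 1 can replace neither i nor
  k, so b is k or lies at or beyond l; both give k \<le> h i. Likewise the position c of w l - 1 can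
  replace neither l nor j, which gives l \<le> h j. Then the occurrence is local.\<close>

lemma globally_no_1324:
  assumes "1 \<le> i" "i < j" "j < k" "k < l" "l \<le> n" "w i < w k" "w k < w j" "w j < w l"
  shows False
  using assms
proof (induction "(w l - w j) + (w k - w i)" arbitrary: i j k l rule: less_induct)
  case less
  note a = less.prems
  have rng: "1 \<le> i" "i \<le> n" "1 \<le> j" "j \<le> n" "1 \<le> k" "k \<le> n" "1 \<le> l" using a by linarith+
  have "1 \<le> Suc (w i)" "Suc (w i) \<le> n" using value_in[of l] a rng by linarith+
  then obtain b where b: "1 \<le> b" "b \<le> n" "w b = Suc (w i)" by (rule position_exists)
  have "1 \<le> w l - 1" "w l - 1 \<le> n" using value_in[of l] value_in[of j] a rng by linarith+
  then obtain c where "1 \<le> c" "c \<le> n" "w c = w l - 1" by (rule position_exists)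
  then have c: "1 \<le> c" "c \<le> n" "w l = Suc (w c)" using a by linarith+
  have "b \<le> h i" using successor_local[of i b] b rng by simp
  have "l \<le> h c" using successor_local[of c l] c a by simp
  have "k \<le> h i"
  proof (cases "b = k")
    case True
    then show ?thesis using \<open>b \<le> h i\<close> by simp
  next
    case False
    then have lt: "w b < w k" using inj[of b k] b a by simp
    have dec: "(w l - w j) + (w k - w b) < (w l - w j) + (w k - w i)"
      "(w l - w j) + (w b - w i) < (w l - w j) + (w k - w i)" using b lt by linarith+
    have "\<not> b < j"
    proof
      assume "b < j"
      then show False using less.hyps[OF dec(1)] a b lt by simp
    qed
    moreover have "\<not> (j < b \<and> b < l)"
    proof
      assume "j < b \<and> b < l"
      then show False using less.hyps[OF dec(2)] a b lt by simp
    qed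
    moreover have "b \<noteq> j" using lt a by auto
    ultimately have "l \<le> b" by linarith
    then show ?thesis using \<open>b \<le> h i\<close> a by linarith
  qed
  moreover have "l \<le> h j"
  proof (cases "c = j")
    case True
    then show ?thesis using \<open>l \<le> h c\<close> by simp
  next
    case False
    then have lt: "w j < w c" using inj[of c j] c a by simp
    have dec: "(w c - w j) + (w k - w i) < (w l - w j) + (w k - w i)"
      "(w l - w c) + (w k - w i) < (w l - w j) + (w k - w i)" using c lt by linarith+
    have "\<not> k < c"
    proof
      assume "k < c"
      then show False using less.hyps[OF dec(1)] a c lt by simp
    qed
    moreover have "\<not> (i < c \<and> c < k)"
    proof
      assume "i < c \<and> c < k"
      then show False using less.hyps[OF dec(2)] a c lt by simp
    qed
    moreover have "c \<noteq> k" using lt a by auto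
    ultimately have "c \<le> j" using a by linarith
    then show ?thesis using \<open>l \<le> h c\<close> h_mono[of c j] c rng by linarith
  qed
  ultimately show False using no_1324[of i j k l] a by simp
qed

lemma patterns_free: "pattern_2143_free n w" "pattern_1324_free n w"
proof -
  show "pattern_2143_free n w"
    unfolding pattern_2143_free_def by (intro allI impI notI) (elim conjE, rule globally_no_2143)
  show "pattern_1324_free n w"
    unfolding pattern_1324_free_def by (intro allI impI notI) (elim conjE, rule globally_no_1324)
qed

end

section \<open>Degrees\<close>

definition hessenberg_pairs :: "nat \<Rightarrow> (nat \<Rightarrow> nat) \<Rightarrow> (nat \<times> nat) set" where
  "hessenberg_pairs n h = {(i, j). i \<in> {1..n} \<and> i < j \<and> j \<le> h i}"

lemma swap_positions_inject:
  assumes "u permutes S" "i < j" "i' < j'" "swap_positions u i j = swap_positions u i' j'"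
  shows "i = i' \<and> j = j'"
proof -
  have "{k. swap_positions u i j k \<noteq> u k} = {i, j}" if "i < j" for i j
    using that permutes_inj[OF assms(1)] by (auto simp: swap_positions_apply dest: injD)
  then have "{i, j} = {i', j'}" using assms by metis
  then show ?thesis using assms(2,3) by (auto simp: doubleton_eq_iff)
qed

text \<open>An edge may be written from either end, but swapping is an involution, so an edge at u
  can be written from u. Its pair is then recovered as the two positions where the ends
  differ.\<close>

lemma degree_Gamma_wh:
  assumes h: "hessenberg n h" and u: "u \<in> bruhat_interval n w (longest_perm n)"
  shows "degree (Gamma_wh n w h) u =
    card {(i, j) \<in> hessenberg_pairs n h. swap_positions u i j \<in> bruhat_interval n w (longest_perm n)}"
    (is "_ = card ?D")
proof -
  let ?I = "bruhat_interval n w (longest_perm n)"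
  have perm: "u permutes {1..n}"
    using u by (simp add: bruhat_interval_def symmetric_group_def)
  have hn: "h i \<le> n" if "i \<in> {1..n}" for i using h that by (auto simp: hessenberg_def)
  define f where "f = (\<lambda>(i, j). {u, swap_positions u i j})"
  have ne: "swap_positions u i j \<noteq> u" if "i < j" for i j
  proof
    assume "swap_positions u i j = u"
    then have "u j = u i" by (metis swap_positions_apply)
    then show False using permutes_inj[OF perm] that by (auto dest: injD)
  qed
  have "inj_on f ?D"
  proof (rule inj_onI, clarify)
    fix i j i' j'
    assume *: "(i, j) \<in> hessenberg_pairs n h" "(i', j') \<in> hessenberg_pairs n h"
      and "f (i, j) = f (i', j')"
    then have lt: "i < j" "i' < j'" by (auto simp: hessenberg_pairs_def)
    have "swap_positions u i j = swap_positions u i' j'"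
      using \<open>f (i, j) = f (i', j')\<close> ne[OF lt(1)] ne[OF lt(2)] by (auto simp: f_def doubleton_eq_iff)
    then show "i = i' \<and> j = j'" using swap_positions_inject[OF perm lt] by blast
  qed
  then have "card (f ` ?D) = card ?D" by (rule card_image)
  moreover have "f ` ?D = {e \<in> snd (Gamma_wh n w h). u \<in> e}"
  proof (intro equalityI subsetI)
    fix e assume "e \<in> f ` ?D"
    then obtain i j where ij: "i \<in> {1..n}" "i < j" "j \<le> h i" "swap_positions u i j \<in> ?I"
      and e: "e = {u, swap_positions u i j}" by (auto simp: f_def hessenberg_pairs_def)
    have "u \<in> symmetric_group n" using perm by (simp add: symmetric_group_def)
    then have "e \<in> snd (Gamma_h n h)" using ij e unfolding Gamma_h_def snd_conv by blast
    then show "e \<in> {e \<in> snd (Gamma_wh n w h). u \<in> e}"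
      using ij e u by (simp add: Gamma_wh_def induced_subgraph_def)
  next
    fix e assume "e \<in> {e \<in> snd (Gamma_wh n w h). u \<in> e}"
    then have e: "e \<in> snd (Gamma_h n h)" "e \<subseteq> ?I" "u \<in> e"
      by (auto simp: Gamma_wh_def induced_subgraph_def)
    then obtain x i j where ij: "i \<in> {1..n}" "i < j" "j \<le> h i" "e = {x, swap_positions x i j}"
      unfolding Gamma_h_def snd_conv by blast
    then have "x = u \<or> x = swap_positions u i j" using e(3) by auto
    then have "e = {u, swap_positions u i j}" using ij(4) by auto
    then show "e \<in> f ` ?D"
      using ij e(2) by (auto simp: f_def hessenberg_pairs_def intro!: image_eqI[of _ _ "(i, j)"])
  qed
  ultimately show ?thesis by (simp only: degree_def)
qed

lemma card_values_less:
  assumes "u permutes {1..n}" "1 \<le> m" "m \<le> n + 1"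
  shows "card {i \<in> {1..n}. u i < m} = m - 1"
proof -
  have "{i \<in> {1..n}. u i < m} = {i \<in> {1..n}. u i \<in> {1..<m}}"
    using permutes_in_image[OF assms(1)] by (simp add: set_eq_iff) blast
  moreover have "{1..<m} \<subseteq> {1..n}" using assms(3) by auto
  ultimately show ?thesis using card_values_permutes[OF assms(1), of "{1..<m}"] by simp
qed

lemma card_values_greater:
  assumes "u permutes {1..n}"
  shows "card {i \<in> {1..n}. c < u i} = n - c"
  using rank_count_full[OF assms, of "Suc c"] by (simp add: rank_count_def Suc_le_eq)

context avoiding_generator
begin

section \<open>Counting blocking entries by row, column and block\<close>

abbreviation "\<mu> \<equiv> prefix_min w"
abbreviation "M \<equiv> suffix_max n w"

lemma board_permutes: "in_board n w u \<Longrightarrow> u permutes {1..n}"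
  by (simp add: in_board_def)

lemma board_lower: "in_board n w u \<Longrightarrow> 1 \<le> i \<Longrightarrow> i \<le> n \<Longrightarrow> \<mu> i \<le> u i"
  by (simp add: in_board_def)

lemma board_upper: "in_board n w u \<Longrightarrow> 1 \<le> i \<Longrightarrow> i \<le> n \<Longrightarrow> u i \<le> M i"
  by (simp add: in_board_def)

text \<open>The entry u j forces some w s < \<open>\<mu> i\<close> with s in the window of i. If w l
  were above \<open>\<mu> i\<close>, then i, s, l would be a 213 against \<open>no_213_far\<close>,
  or k, i, s, l with w k = \<open>\<mu> i\<close> a 2413 against
  \<open>no_2413_far_right\<close>.\<close>

lemma small_in_window:
  assumes u: "in_board n w u" and "1 \<le> i" "i \<le> n" "1 \<le> j" "j \<le> h i" "u j < \<mu> i"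
    and l: "h i < l" "l \<le> n"
  shows "w l < \<mu> i"
proof (rule ccontr)
  assume "\<not> w l < \<mu> i"
  have "j \<le> n" using assms h_range[of i] by linarith
  obtain s where s: "1 \<le> s" "s \<le> j" "w s = \<mu> j" using prefix_min_attained[OF \<open>1 \<le> j\<close>] .
  have "w s < \<mu> i" using s board_lower[OF u \<open>1 \<le> j\<close> \<open>j \<le> n\<close>] assms by linarith
  then have "i < s" using prefix_min_le[of s i w] s by linarith
  obtain k where k: "1 \<le> k" "k \<le> i" "w k = \<mu> i" using prefix_min_attained[OF \<open>1 \<le> i\<close>] .
  have "i < l" using l h_range[of i] assms by linarith
  then have "l \<noteq> k" "l \<noteq> i" using k by linarith+
  then have "w l \<noteq> w k" "w l \<noteq> w i" by (simp_all add: inj)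
  have "\<mu> i \<le> w i" using prefix_min_le[of i i w] assms by simp
  show False
  proof (cases "w i < w l")
    case True
    then show False
      using no_213_far[of i s l] assms(2-5) l s(2) \<open>i < s\<close> \<open>w s < \<mu> i\<close> \<open>\<mu> i \<le> w i\<close> by simp
  next
    case False
    then have "w l < w i" using \<open>w l \<noteq> w i\<close> by simp
    then have "k \<noteq> i" using \<open>\<not> w l < \<mu> i\<close> k by auto
    then have "k < i" using k by simp
    moreover have "w k < w l" using \<open>\<not> w l < \<mu> i\<close> \<open>w l \<noteq> w k\<close> k by simp
    ultimately show False
      using no_2413_far_right[of k i s l] assms(2-5) l s(2) k \<open>i < s\<close> \<open>w s < \<mu> i\<close> \<open>w l < w i\<close>
      by simp
  qed
qed

text \<open>Some t < j has w t > \<open>M j\<close> and reaches j, so p < t. A smaller w p would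
  make p, t, j a 132 against \<open>no_132_far\<close>, or p, t, j, l with w l = \<open>M j\<close>
  a 2413 against \<open>no_2413_far_left\<close>.\<close>

lemma large_in_window:
  assumes u: "in_board n w u" and "1 \<le> i" "i \<le> n" "j \<le> h i" "j \<le> n" "M j < u i"
    and p: "1 \<le> p" "p \<le> n" "h p < j"
  shows "M j < w p"
proof (rule ccontr)
  assume "\<not> M j < w p"
  obtain t where t: "i \<le> t" "t \<le> n" "w t = M i" using suffix_max_attained[OF \<open>i \<le> n\<close>] .
  have "M j < w t" using t board_upper[OF u \<open>1 \<le> i\<close> \<open>i \<le> n\<close>] assms by linarith
  have "t < j"
  proof (rule ccontr)
    assume "\<not> t < j"
    then show False using suffix_max_ge[of j t n w] t \<open>M j < w t\<close> by simp
  qed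
  have "j \<le> h t" using h_mono[of i t] t assms by simp
  have "p < t"
  proof (rule ccontr)
    assume "\<not> p < t"
    then show False using h_mono[of t p] assms t \<open>j \<le> h t\<close> by simp
  qed
  obtain l where l: "j \<le> l" "l \<le> n" "w l = M j" using suffix_max_attained[OF \<open>j \<le> n\<close>] .
  have "w j \<le> M j" using suffix_max_ge[of j j n w] \<open>j \<le> n\<close> by simp
  have "p \<noteq> l" "p \<noteq> j" using l \<open>p < t\<close> \<open>t < j\<close> by linarith+
  then have "w p \<noteq> w l" "w p \<noteq> w j" by (simp_all add: inj)
  show False
  proof (cases "w p < w j")
    case True
    then show False
      using no_132_far[of p t j] p \<open>j \<le> n\<close> \<open>p < t\<close> \<open>t < j\<close> \<open>j \<le> h t\<close> \<open>w j \<le> M j\<close> \<open>M j < w t\<close>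
      by simp
  next
    case False
    then have "w j < w p" using \<open>w p \<noteq> w j\<close> by simp
    then have "j \<noteq> l" using \<open>\<not> M j < w p\<close> l by auto
    then have "j < l" using l by simp
    moreover have "w p < w l" using \<open>\<not> M j < w p\<close> \<open>w p \<noteq> w l\<close> l by simp
    ultimately show False
      using no_2413_far_left[of p t j l] p \<open>p < t\<close> \<open>t < j\<close> \<open>j \<le> h t\<close> l \<open>M j < w t\<close> \<open>w j < w p\<close>
      by simp
  qed
qed

lemma mu_range: "1 \<le> i \<Longrightarrow> i \<le> n \<Longrightarrow> 1 \<le> \<mu> i \<and> \<mu> i \<le> n"
  using value_in by (metis prefix_min_attained le_trans)

lemma finite_hessenberg_pairs: "finite (hessenberg_pairs n h)"
  by (rule finite_subset[of _ "{1..n} \<times> {1..n}"])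
     (use h_range in \<open>force simp: hessenberg_pairs_def\<close>)+

text \<open>By \<open>small_in_window\<close>, the row is empty unless w stays below
  \<open>\<mu> i\<close> beyond the window, and then so does u, by the upper border. In that case
  the \<open>\<mu> i - 1\<close> small values all lie right of i, and n - h i of them beyond the
  window.\<close>

lemma card_row:
  assumes u: "in_board n w u" and i: "1 \<le> i" "i \<le> n"
  shows "card {j. i < j \<and> j \<le> h i \<and> u j < \<mu> i} =
    (if \<forall>l. h i < l \<longrightarrow> l \<le> n \<longrightarrow> w l < \<mu> i then (\<mu> i - 1) - (n - h i) else 0)"
proof (cases "\<forall>l. h i < l \<longrightarrow> l \<le> n \<longrightarrow> w l < \<mu> i")
  case True
  have "i < j" if "1 \<le> j" "j \<le> n" "u j < \<mu> i" for j
  proof (rule ccontr)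
    assume "\<not> i < j"
    then show False
      using board_lower[OF u that(1,2)] prefix_min_antimono[of j i w] that by simp
  qed
  moreover have "u l < \<mu> i" if l: "h i < l" "l \<le> n" for l
  proof -
    obtain l' where l': "l \<le> l'" "l' \<le> n" "w l' = M l" using suffix_max_attained[OF l(2)] .
    then have "M l < \<mu> i" using True l by (metis less_le_trans)
    then show ?thesis using board_upper[OF u _ l(2)] l by simp
  qed
  ultimately have "{j. i < j \<and> j \<le> h i \<and> u j < \<mu> i} = {j \<in> {1..n}. u j < \<mu> i} - {h i<..n}"
    using i h_range[OF i] by (auto simp: not_less)
  moreover have "{h i<..n} \<subseteq> {j \<in> {1..n}. u j < \<mu> i}"
    using \<open>\<And>l. h i < l \<Longrightarrow> l \<le> n \<Longrightarrow> u l < \<mu> i\<close> by auto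
  ultimately have "card {j. i < j \<and> j \<le> h i \<and> u j < \<mu> i} = card {j \<in> {1..n}. u j < \<mu> i} - card {h i<..n}"
    by (simp add: card_Diff_subset)
  then show ?thesis
    using True card_values_less[OF board_permutes[OF u], of "\<mu> i"] mu_range[OF i] by simp
next
  case False
  have "{j. i < j \<and> j \<le> h i \<and> u j < \<mu> i} = {}"
  proof (intro equals0I, clarify)
    fix j assume "i < j" "j \<le> h i" "u j < \<mu> i"
    then show False using small_in_window[OF u i, of j] False i by simp
  qed
  then show ?thesis unfolding if_not_P[OF False] by (simp only: card.empty)
qed

text \<open>Dual to \<open>card_row\<close>, with the positions p that do not reach j in place of
  those beyond the window.\<close>

lemma card_column:
  assumes u: "in_board n w u" and j: "1 \<le> j" "j \<le> n"
  shows "card {i \<in> {1..n}. i < j \<and> j \<le> h i \<and> M j < u i} =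
    (if \<forall>p. 1 \<le> p \<longrightarrow> p \<le> n \<longrightarrow> h p < j \<longrightarrow> M j < w p
     then (n - M j) - card {p \<in> {1..n}. h p < j} else 0)"
proof (cases "\<forall>p. 1 \<le> p \<longrightarrow> p \<le> n \<longrightarrow> h p < j \<longrightarrow> M j < w p")
  case True
  have "i < j" if "1 \<le> i" "i \<le> n" "M j < u i" for i
  proof (rule ccontr)
    assume "\<not> i < j"
    then show False
      using board_upper[OF u that(1,2)] suffix_max_antimono[of j i n w] that by simp
  qed
  moreover have large: "M j < u p" if p: "1 \<le> p" "p \<le> n" "h p < j" for p
  proof -
    obtain p' where p': "1 \<le> p'" "p' \<le> p" "w p' = \<mu> p" using prefix_min_attained[OF p(1)] .
    then have "h p' < j" using h_mono[of p' p] p by simp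
    moreover have "p' \<le> n" using p' p by simp
    ultimately have "M j < w p'" using True p'(1) by blast
    then show ?thesis using board_lower[OF u p(1,2)] p' by simp
  qed
  ultimately have "{i \<in> {1..n}. i < j \<and> j \<le> h i \<and> M j < u i} =
      {i \<in> {1..n}. M j < u i} - {p \<in> {1..n}. h p < j}"
    by (auto simp: not_less)
  moreover have "{p \<in> {1..n}. h p < j} \<subseteq> {i \<in> {1..n}. M j < u i}"
    using large by auto
  ultimately have "card {i \<in> {1..n}. i < j \<and> j \<le> h i \<and> M j < u i} =
      card {i \<in> {1..n}. M j < u i} - card {p \<in> {1..n}. h p < j}"
    by (simp add: card_Diff_subset)
  then show ?thesis using True card_values_greater[OF board_permutes[OF u], of "M j"] by simp
next
  case False
  then have "{i \<in> {1..n}. i < j \<and> j \<le> h i \<and> M j < u i} = {}"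
    using large_in_window[OF u] j by auto
  then show ?thesis unfolding if_not_P[OF False] by (simp only: card.empty)
qed

text \<open>If the number of these entries depended on \<open>u\<close>, there would be a 2143 in \<open>w\<close>.\<close>

lemma card_large_in_block:
  assumes u: "in_board n w u" and "m \<le> c" and p: "1 \<le> p" "p \<le> n" "\<mu> p = m"
    and q: "1 \<le> q" "q \<le> n" "M q = c"
  shows "card {i \<in> {1..n}. \<mu> i = m \<and> c < u i} =
    (if \<forall>i\<in>{1..n}. m < \<mu> i \<longrightarrow> c < w i then (n - c) - card {i \<in> {1..n}. m < \<mu> i} else 0)"
proof -
  obtain k where k: "1 \<le> k" "k \<le> p" "w k = m" using prefix_min_attained[OF p(1), of w] p(3) by metis
  obtain r where r: "q \<le> r" "r \<le> n" "w r = c" using suffix_max_attained[OF q(2), of w] q(3) by metis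
  \<comment> \<open>A large entry of u at i needs an entry of w above c at or after i; since M q =
    c, it stands before q.\<close>
  have large: "\<exists>l. i \<le> l \<and> l < r \<and> c < w l" if i: "i \<in> {1..n}" "c < u i" for i
  proof -
    have i': "1 \<le> i" "i \<le> n" using i by auto
    obtain l where l: "i \<le> l" "l \<le> n" "w l = M i" using suffix_max_attained[OF i'(2)] .
    have "c < w l" using board_upper[OF u i'] l i by simp
    moreover have "l < q"
    proof (rule ccontr)
      assume "\<not> l < q"
      then show False using suffix_max_ge[of q l n w] l q \<open>c < w l\<close> by simp
    qed
    ultimately show ?thesis using l r by auto
  qed
  \<comment> \<open>Otherwise the prefix minimum drops below m at some s between k and l, and k, s,
    l, r is a 2143 in w.\<close>
  have low: "m \<le> \<mu> i" if i: "i \<in> {1..n}" "c < u i" for i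
  proof (rule ccontr)
    assume "\<not> m \<le> \<mu> i"
    obtain l where l: "i \<le> l" "l < r" "c < w l" using large[OF i] by blast
    obtain s where s: "1 \<le> s" "s \<le> i" "w s = \<mu> i" using prefix_min_attained[of i w] i by auto
    have "w s < m" using s \<open>\<not> m \<le> \<mu> i\<close> by simp
    have "p < s"
    proof (rule ccontr)
      assume "\<not> p < s"
      then show False using prefix_min_le[of s p w] s p \<open>w s < m\<close> by simp
    qed
    have "s \<noteq> l" using \<open>w s < m\<close> l \<open>m \<le> c\<close> by auto
    then have "s < l" using s l by simp
    moreover have "k < s" using k \<open>p < s\<close> by simp
    moreover have "w k \<noteq> w r" using inj \<open>k < s\<close> \<open>s < l\<close> l by simp
    ultimately show False
      using globally_no_2143[of k s l r] k r l \<open>w s < m\<close> \<open>m \<le> c\<close> by simp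
  qed
  have "{i \<in> {1..n}. \<mu> i = m \<and> c < u i} = {i \<in> {1..n}. c < u i} - {i \<in> {1..n}. m < \<mu> i}"
    using low by force
  moreover have "card {i \<in> {1..n}. c < u i} = n - c"
    by (rule card_values_greater[OF board_permutes[OF u]])
  moreover have "{i \<in> {1..n}. m < \<mu> i} \<subseteq> {i \<in> {1..n}. c < u i}"
    if all: "\<forall>i\<in>{1..n}. m < \<mu> i \<longrightarrow> c < w i"
  proof clarify
    fix i assume i: "i \<in> {1..n}" "m < \<mu> i"
    obtain s where s: "1 \<le> s" "s \<le> i" "w s = \<mu> i" using prefix_min_attained[of i w] i by auto
    have "\<mu> i \<le> \<mu> s" using prefix_min_antimono[OF s(1,2)] .
    then have "m < \<mu> s" "s \<in> {1..n}" using s i by auto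
    then have "c < w s" using all by blast
    then show "c < u i" using board_lower[OF u, of i] i s by simp
  qed
  moreover have "{i \<in> {1..n}. \<mu> i = m \<and> c < u i} = {}"
    if ex: "\<not> (\<forall>i\<in>{1..n}. m < \<mu> i \<longrightarrow> c < w i)"
  proof -
    \<comment> \<open>The position a precedes k, where the prefix minimum becomes m, so a, k, l, r
      would be a 2143 in w.\<close>
    obtain a where a: "1 \<le> a" "a \<le> n" "m < \<mu> a" "w a \<le> c" using ex by (auto simp: not_less)
    have False if i: "i \<in> {1..n}" "\<mu> i = m" "c < u i" for i
    proof -
      obtain l where l: "i \<le> l" "l < r" "c < w l" using large[OF i(1,3)] by blast
      obtain s where s: "1 \<le> s" "s \<le> i" "w s = \<mu> i" using prefix_min_attained[of i w] i by auto
      have "s = k" using inj[of s k] s k i by simp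
      then have "k < l" using s l k \<open>m \<le> c\<close> by (cases "k = l") auto
      have "a < k"
      proof (rule ccontr)
        assume "\<not> a < k"
        then show False using prefix_min_le[of k a w] k a by simp
      qed
      have "w a \<noteq> w r" using inj \<open>a < k\<close> \<open>k < l\<close> l by simp
      moreover have "m < w a" using prefix_min_le[of a a w] a by simp
      ultimately show False
        using globally_no_2143[of a k l r] a k r l \<open>a < k\<close> \<open>k < l\<close> by simp
    qed
    then show ?thesis by blast
  qed
  ultimately show ?thesis by (simp add: card_Diff_subset)
qed

text \<open>Dual to \<open>card_large_in_block\<close>. The forbidden 2143 is k, s, l, r if a small
  entry of u lies in a column with \<open>M j > c\<close>, and k, s, r, b if the stated condition on
  w fails at b.\<close>

lemma card_small_in_block:
  assumes u: "in_board n w u" and "m \<le> c" and p: "1 \<le> p" "p \<le> n" "\<mu> p = m"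
    and q: "1 \<le> q" "q \<le> n" "M q = c"
  shows "card {j \<in> {1..n}. M j = c \<and> u j < m} =
    (if \<forall>j\<in>{1..n}. M j < c \<longrightarrow> w j < m then (m - 1) - card {j \<in> {1..n}. M j < c} else 0)"
proof -
  obtain k where k: "1 \<le> k" "k \<le> p" "w k = m" using prefix_min_attained[OF p(1), of w] p(3) by metis
  obtain r where r: "q \<le> r" "r \<le> n" "w r = c" using suffix_max_attained[OF q(2), of w] q(3) by metis
  have small: "\<exists>s. 1 \<le> s \<and> s \<le> j \<and> k < s \<and> w s < m" if j: "j \<in> {1..n}" "u j < m" for j
  proof -
    have j': "1 \<le> j" "j \<le> n" using j by auto
    obtain s where s: "1 \<le> s" "s \<le> j" "w s = \<mu> j" using prefix_min_attained[OF j'(1)] .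
    have "w s < m" using board_lower[OF u j'] s j by simp
    moreover have "p < s"
    proof (rule ccontr)
      assume "\<not> p < s"
      then show False using prefix_min_le[of s p w] s p \<open>w s < m\<close> by simp
    qed
    ultimately show ?thesis using s(1,2) k(2) by (intro exI[of _ s]) simp
  qed
  have high: "M j \<le> c" if j: "j \<in> {1..n}" "u j < m" for j
  proof (rule ccontr)
    assume "\<not> M j \<le> c"
    obtain s where s: "1 \<le> s" "s \<le> j" "k < s" "w s < m" using small[OF j] by blast
    obtain l where l: "j \<le> l" "l \<le> n" "w l = M j" using suffix_max_attained[of j n w] j by auto
    have "c < w l" using l \<open>\<not> M j \<le> c\<close> by simp
    have "l < q"
    proof (rule ccontr)
      assume "\<not> l < q"
      then show False using suffix_max_ge[of q l n w] l q \<open>c < w l\<close> by simp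
    qed
    have "s \<noteq> l" using s \<open>c < w l\<close> \<open>m \<le> c\<close> by auto
    then have "s < l" using s l by simp
    moreover have "l < r" using r \<open>l < q\<close> by simp
    moreover have "w k \<noteq> w r" using inj \<open>k < s\<close> \<open>s < l\<close> \<open>l < r\<close> by simp
    ultimately show False
      using globally_no_2143[of k s l r] k r s \<open>c < w l\<close> \<open>m \<le> c\<close> by simp
  qed
  have "{j \<in> {1..n}. M j = c \<and> u j < m} = {j \<in> {1..n}. u j < m} - {j \<in> {1..n}. M j < c}"
    using high by force
  moreover have "card {j \<in> {1..n}. u j < m} = m - 1"
    using card_values_less[OF board_permutes[OF u], of m] mu_range[OF p(1,2)] p(3) by simp
  moreover have "{j \<in> {1..n}. M j < c} \<subseteq> {j \<in> {1..n}. u j < m}"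
    if all: "\<forall>j\<in>{1..n}. M j < c \<longrightarrow> w j < m"
  proof clarify
    fix j assume j: "j \<in> {1..n}" "M j < c"
    obtain l where l: "j \<le> l" "l \<le> n" "w l = M j" using suffix_max_attained[of j n w] j by auto
    have "M l \<le> M j" using suffix_max_antimono[OF l(1,2)] .
    then have "M l < c" "l \<in> {1..n}" using l j by auto
    then have "w l < m" using all by blast
    then show "u j < m" using board_upper[OF u, of j] j l by simp
  qed
  moreover have "{j \<in> {1..n}. M j = c \<and> u j < m} = {}"
    if ex: "\<not> (\<forall>j\<in>{1..n}. M j < c \<longrightarrow> w j < m)"
  proof -
    obtain b where b: "1 \<le> b" "b \<le> n" "M b < c" "m \<le> w b" using ex by (auto simp: not_less)
    have False if j: "j \<in> {1..n}" "M j = c" "u j < m" for j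
    proof -
      obtain s where s: "1 \<le> s" "s \<le> j" "k < s" "w s < m" using small[OF j(1,3)] by blast
      obtain l where l: "j \<le> l" "l \<le> n" "w l = M j" using suffix_max_attained[of j n w] j by auto
      have "l = r" using inj[of l r] l r j by simp
      then have "s < r" using s l r \<open>m \<le> c\<close> by (cases "s = r") auto
      have "r < b"
      proof (rule ccontr)
        assume "\<not> r < b"
        then show False using suffix_max_ge[of b r n w] r b by simp
      qed
      have "w k \<noteq> w b" using inj \<open>k < s\<close> \<open>s < r\<close> \<open>r < b\<close> by simp
      moreover have "w b < c" using suffix_max_ge[of b b n w] b by simp
      ultimately show False
        using globally_no_2143[of k s r b] b k r s \<open>s < r\<close> \<open>r < b\<close> by simp
    qed
    then show ?thesis by blast
  qed
  ultimately show ?thesis by (simp add: card_Diff_subset)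
qed

end

lemma card_eq_if_fibers_eq:
  assumes "finite S" "finite T" "\<And>y. card {x \<in> S. g x = y} = card {x \<in> T. g x = y}"
  shows "card S = card T"
proof -
  let ?Y = "g ` S \<union> g ` T"
  have "card S = (\<Sum>y\<in>?Y. card {x \<in> S. g x = y})"
    using sum.group[of S ?Y g "\<lambda>_. 1 :: nat"] assms(1,2) by simp
  moreover have "card T = (\<Sum>y\<in>?Y. card {x \<in> T. g x = y})"
    using sum.group[of T ?Y g "\<lambda>_. 1 :: nat"] assms(1,2) by simp
  ultimately show ?thesis using assms(3) by simp
qed

context avoiding_generator
begin

lemma hessenberg_pairs_range:
  "(i, j) \<in> hessenberg_pairs n h \<Longrightarrow> i \<in> {1..n} \<and> j \<in> {1..n} \<and> i < j"
  using h_range[of i] by (auto simp: hessenberg_pairs_def)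

text \<open>By \<open>in_board_swap_iff\<close>, this and the next set collect the two ways in which
  a swap leaves the board.\<close>

definition lower_blocked :: "(nat \<Rightarrow> nat) \<Rightarrow> (nat \<times> nat) set" where
  "lower_blocked u = {(i, j) \<in> hessenberg_pairs n h. u j < \<mu> i}"

definition upper_blocked :: "(nat \<Rightarrow> nat) \<Rightarrow> (nat \<times> nat) set" where
  "upper_blocked u = {(i, j) \<in> hessenberg_pairs n h. M j < u i}"

lemma finite_blocked: "finite (lower_blocked u)" "finite (upper_blocked u)"
  unfolding lower_blocked_def upper_blocked_def
  by (auto intro: finite_subset[OF _ finite_hessenberg_pairs])

lemma card_lower_blocked_eq:
  assumes "in_board n w u" "in_board n w v"
  shows "card (lower_blocked u) = card (lower_blocked v)"
proof (rule card_eq_if_fibers_eq[where g = fst])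
  fix i
  have "{x \<in> lower_blocked u. fst x = i} =
    (if i \<in> {1..n} then {i} \<times> {j. i < j \<and> j \<le> h i \<and> u j < \<mu> i} else {})" for u
    by (auto simp: lower_blocked_def hessenberg_pairs_def)
  then show "card {x \<in> lower_blocked u. fst x = i} = card {x \<in> lower_blocked v. fst x = i}"
    using card_row[OF assms(1), of i] card_row[OF assms(2), of i]
    by (simp add: card_cartesian_product)
qed (rule finite_blocked)+

lemma card_upper_blocked_eq:
  assumes "in_board n w u" "in_board n w v"
  shows "card (upper_blocked u) = card (upper_blocked v)"
proof (rule card_eq_if_fibers_eq[where g = snd])
  fix j
  have fiber: "{x \<in> upper_blocked u. snd x = j} =
    (if j \<in> {1..n} then {i \<in> {1..n}. i < j \<and> j \<le> h i \<and> M j < u i} \<times> {j} else {})" for u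
  proof (cases "j \<in> {1..n}")
    case True
    then show ?thesis by (auto simp: upper_blocked_def hessenberg_pairs_def)
  next
    case False
    have "x \<notin> upper_blocked u \<or> snd x \<noteq> j" for x
      using hessenberg_pairs_range[of "fst x" "snd x"] False
      by (auto simp: upper_blocked_def)
    then show ?thesis unfolding if_not_P[OF False] by blast
  qed
  show "card {x \<in> upper_blocked u. snd x = j} = card {x \<in> upper_blocked v. snd x = j}"
  proof (cases "j \<in> {1..n}")
    case True
    then have j: "1 \<le> j" "j \<le> n" by auto
    show ?thesis
      unfolding fiber if_P[OF True] card_cartesian_product
        card_column[OF assms(1) j] card_column[OF assms(2) j] ..
  next
    case False
    show ?thesis unfolding fiber if_not_P[OF False] ..
  qed
qed (rule finite_blocked)+

text \<open>One doubly blocked pair makes its whole block local. If a did not reach j, neither would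
  the position k of its prefix minimum, and \<open>large_in_window\<close> would give m = w k > c.
  If a reached j but not b, \<open>small_in_window\<close> would give c < m.\<close>

lemma block_local:
  assumes u: "in_board n w u" and "m \<le> c"
    and ij: "(i, j) \<in> hessenberg_pairs n h" "\<mu> i = m" "M j = c" "u j < m" "c < u i"
    and a: "1 \<le> a" "a \<le> n" "\<mu> a = m" and b: "1 \<le> b" "b \<le> n" "M b = c"
  shows "b \<le> h a"
proof (rule ccontr)
  assume "\<not> b \<le> h a"
  have ij': "1 \<le> i" "i \<le> n" "i < j" "j \<le> h i" "1 \<le> j" "j \<le> n"
    using ij(1) h_range[of i] by (auto simp: hessenberg_pairs_def)
  have "j \<le> h a"
  proof (rule ccontr)
    assume "\<not> j \<le> h a"
    obtain k where k: "1 \<le> k" "k \<le> a" "w k = \<mu> a" using prefix_min_attained[OF a(1)] .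
    have "h k < j" using h_mono[of k a] k a \<open>\<not> j \<le> h a\<close> by simp
    then have "M j < w k" using large_in_window[OF u ij'(1,2,4,6) _ k(1)] ij k a by simp
    then show False using ij a k \<open>m \<le> c\<close> by simp
  qed
  obtain l where l: "b \<le> l" "l \<le> n" "w l = M b" using suffix_max_attained[OF b(2)] .
  have "w l < \<mu> a"
    using small_in_window[OF u a(1,2) ij'(5) \<open>j \<le> h a\<close>, of l] ij a l \<open>\<not> b \<le> h a\<close> by simp
  then show False using l a b \<open>m \<le> c\<close> by simp
qed

text \<open>The pair (i, j) is blocked for u, yet it describes the block for every v:
  \<open>block_local\<close> supplies the reach condition, and a < b follows from v b < m =
  \<open>\<mu> a\<close>. What remains are separate conditions on v a and v b.\<close>

lemma doubly_blocked_block: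
  assumes u: "in_board n w u" and v: "in_board n w v" and "m \<le> c"
    and ij: "(i, j) \<in> lower_blocked u \<inter> upper_blocked u" "\<mu> i = m" "M j = c"
  shows "{x \<in> lower_blocked v \<inter> upper_blocked v. (\<mu> (fst x), M (snd x)) = (m, c)} =
    {a \<in> {1..n}. \<mu> a = m \<and> c < v a} \<times> {b \<in> {1..n}. M b = c \<and> v b < m}" (is "?L = ?A \<times> ?B")
proof
  show "?L \<subseteq> ?A \<times> ?B"
  proof
    fix x assume "x \<in> ?L"
    moreover obtain a b where x: "x = (a, b)" by force
    ultimately have ab: "(a, b) \<in> lower_blocked v" "(a, b) \<in> upper_blocked v" "\<mu> a = m" "M b = c"
      by auto
    then have "a \<in> {1..n} \<and> b \<in> {1..n}"
      using hessenberg_pairs_range[of a b] by (simp add: lower_blocked_def)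
    then show "x \<in> ?A \<times> ?B"
      using ab by (simp add: x lower_blocked_def upper_blocked_def)
  qed
  have ij': "(i, j) \<in> hessenberg_pairs n h" "u j < m" "c < u i"
    using ij by (simp_all add: lower_blocked_def upper_blocked_def)
  show "?A \<times> ?B \<subseteq> ?L"
  proof
    fix x assume "x \<in> ?A \<times> ?B"
    moreover obtain a b where x: "x = (a, b)" by force
    ultimately have ab: "1 \<le> a" "a \<le> n" "\<mu> a = m" "1 \<le> b" "b \<le> n" "M b = c" "c < v a" "v b < m"
      by simp_all
    have "b \<le> h a" by (rule block_local[OF u \<open>m \<le> c\<close> ij'(1) ij(2,3) ij'(2,3) ab(1-6)])
    moreover have "a < b"
    proof (rule ccontr)
      assume "\<not> a < b"
      then show False
        using board_lower[OF v ab(4,5)] prefix_min_antimono[of b a w] ab by simp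
    qed
    ultimately show "x \<in> ?L"
      using ab by (simp add: x lower_blocked_def upper_blocked_def hessenberg_pairs_def)
  qed
qed

lemma card_doubly_blocked_eq:
  assumes u: "in_board n w u" and v: "in_board n w v"
  shows "card (lower_blocked u \<inter> upper_blocked u) = card (lower_blocked v \<inter> upper_blocked v)"
proof (rule card_eq_if_fibers_eq[where g = "\<lambda>x. (\<mu> (fst x), M (snd x))"])
  fix y
  define F where
    "F u = {x \<in> lower_blocked u \<inter> upper_blocked u. (\<mu> (fst x), M (snd x)) = y}" for u
  obtain m c where y: "y = (m, c)" by force
  have "card (F u) = card (F v)"
  proof (cases "m \<le> c")
    case False
    \<comment> \<open>For c < m the borders block every pair of the block: u j \<le> c < m \<le> u
      i.\<close>
    have "F u = {x \<in> hessenberg_pairs n h. (\<mu> (fst x), M (snd x)) = (m, c)}"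
      if u: "in_board n w u" for u
    proof -
      have "u j < \<mu> i \<and> M j < u i"
        if ij: "(i, j) \<in> hessenberg_pairs n h" "\<mu> i = m" "M j = c" for i j
      proof -
        have "1 \<le> i" "i \<le> n" "1 \<le> j" "j \<le> n"
          using ij(1) h_range[of i] by (auto simp: hessenberg_pairs_def)
        then show ?thesis using board_lower[OF u, of i] board_upper[OF u, of j] ij False by simp
      qed
      then show ?thesis by (auto simp: F_def y lower_blocked_def upper_blocked_def)
    qed
    then show ?thesis using u v by simp
  next
    case True
    \<comment> \<open>The witness u' may be either u or v; a single doubly blocked pair gives the
      same product formula for both.\<close>
    have eq: "card (F u) = card (F v)"
      if ne: "F u' \<noteq> {}" and u': "in_board n w u'" for u'
    proof -
      obtain i j where ij: "(i, j) \<in> lower_blocked u' \<inter> upper_blocked u'" "\<mu> i = m" "M j = c"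
        using ne by (auto simp: F_def y)
      then have "(i, j) \<in> hessenberg_pairs n h" by (simp add: lower_blocked_def)
      then have rng: "1 \<le> i" "i \<le> n" "1 \<le> j" "j \<le> n"
        using hessenberg_pairs_range[of i j] by auto
      have "card (F x) =
          (if \<forall>i\<in>{1..n}. m < \<mu> i \<longrightarrow> c < w i then (n - c) - card {i \<in> {1..n}. m < \<mu> i} else 0) *
          (if \<forall>j\<in>{1..n}. M j < c \<longrightarrow> w j < m then (m - 1) - card {j \<in> {1..n}. M j < c} else 0)"
        if x: "in_board n w x" for x
        unfolding F_def y doubly_blocked_block[OF u' x True ij] card_cartesian_product
          card_large_in_block[OF x True rng(1,2) ij(2) rng(3,4) ij(3)]
          card_small_in_block[OF x True rng(1,2) ij(2) rng(3,4) ij(3)] ..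
      then show ?thesis using u v by simp
    qed
    show ?thesis
    proof (cases "F u = {} \<and> F v = {}")
      case True
      then show ?thesis by simp
    next
      case False
      then show ?thesis using eq[OF _ u] eq[OF _ v] by blast
    qed
  qed
  then show "card {x \<in> lower_blocked u \<inter> upper_blocked u. (\<mu> (fst x), M (snd x)) = y} =
      card {x \<in> lower_blocked v \<inter> upper_blocked v. (\<mu> (fst x), M (snd x)) = y}"
    by (simp add: F_def)
qed (simp_all add: finite_blocked)

lemma interval_eq_board: "bruhat_interval n w (longest_perm n) = {u. in_board n w u}"
  by (rule bruhat_interval_longest_perm[OF w_permutes patterns_free])

lemma degree_eq:
  assumes u: "in_board n w u"
  shows "degree (Gamma_wh n w h) u = card (hessenberg_pairs n h) -
    (card (lower_blocked u) + card (upper_blocked u) - card (lower_blocked u \<inter> upper_blocked u))"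
proof -
  let ?E = "hessenberg_pairs n h" and ?N = "lower_blocked u \<union> upper_blocked u"
  have "in_board n w (swap_positions u i j) \<longleftrightarrow> (i, j) \<notin> ?N" if ij: "(i, j) \<in> ?E" for i j
  proof -
    have "1 \<le> i" "i < j" "j \<le> n" using hessenberg_pairs_range[OF ij] by auto
    then have "in_board n w (swap_positions u i j) \<longleftrightarrow> \<mu> i \<le> u j \<and> u i \<le> M j"
      by (rule in_board_swap_iff[OF u])
    also have "\<dots> \<longleftrightarrow> (i, j) \<notin> ?N"
      using ij by (simp add: lower_blocked_def upper_blocked_def not_less)
    finally show ?thesis .
  qed
  then have "{(i, j) \<in> ?E. in_board n w (swap_positions u i j)} = ?E - ?N" by blast
  moreover have "?N \<subseteq> ?E" by (auto simp: lower_blocked_def upper_blocked_def)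
  then have "card (?E - ?N) = card ?E - card ?N"
    using finite_blocked by (intro card_Diff_subset) auto
  moreover have "card ?N =
      card (lower_blocked u) + card (upper_blocked u) - card (lower_blocked u \<inter> upper_blocked u)"
    using card_Un_Int[OF finite_blocked, of u u] by linarith
  ultimately show ?thesis
    using degree_Gamma_wh[OF hessenberg, of u w] u unfolding interval_eq_board mem_Collect_eq
    by presburger
qed

lemma regular: "regular_graph (Gamma_wh n w h)"
proof -
  have "fst (Gamma_wh n w h) \<subseteq> {u. in_board n w u}"
    by (auto simp: Gamma_wh_def induced_subgraph_def interval_eq_board)
  moreover have "degree (Gamma_wh n w h) u = degree (Gamma_wh n w h) v"
    if "in_board n w u" "in_board n w v" for u v
    unfolding degree_eq[OF that(1)] degree_eq[OF that(2)]
      card_lower_blocked_eq[OF that] card_upper_blocked_eq[OF that] card_doubly_blocked_eq[OF that] ..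
  ultimately show ?thesis unfolding regular_graph_def by blast
qed

end

theorem theorem4p8:
  fixes n :: nat and h w :: "nat \<Rightarrow> nat"
  assumes "hessenberg n h"
    and "is_generator n h w"
    and "\<not> contains_2143 n h w"
    and "\<not> contains_1324 n h w"
    and "\<not> contains_1243 n h w"
    and "\<not> contains_2134 n h w"
    and "\<not> contains_1423 n h w"
    and "\<not> contains_2314 n h w"
    and "\<not> contains_2413 n h w"
  shows "regular_graph (Gamma_wh n w h)"
proof -
  interpret avoiding_generator n h w
    by unfold_locales (fact assms)+
  show ?thesis by (rule regular)
qed

end
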